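(* Let $k\ge2$, $1\le s\le k-1$, $0<\delta<1$, and let $F$ be a $k$-graph. Suppose $0<1/n\ll\theta\ll\epsilon\ll1/k$ (with the implicit functions allowed to depend on $F$). Let $H$ be a $k$-graph on a set $X$ of $n$ vertices such that $d_{F^{+s}}(H)<\theta$ and the $s$-graph $G=\{S\in\binom{X}{s}: |N_H(S)|<\delta\binom{n-s}{k-s}\}$ has density $d(G)<\theta$. Then there is $Z\subseteq X$ with $|Z|>(\delta-\epsilon)n$ and $d_F(H[Z])<\epsilon$.
   Context: Hierarchy convention: "$0<\alpha\ll\beta$" means there is an increasing function $f$ such that the statement holds whenever $0<\alpha<f(\beta)$; chains are read right to left. For a $k$-graph $H$ and $S\subseteq V(H)$, $N_H(S)=\{T\subseteq V(H)\setminus S:S\cup T\in E(H)\}$. $H[Z]$ is the $k$-graph on $Z$ of edges of $H$ contained in $Z$. The density of an $s$-graph $G$ on $n$ vertices is $d(G)=s!|E(G)|/n^s$. The homomorphism density $d_F(H)$ is the probability that a uniformly random map $\phi:V(F)\to V(H)$ satisfies $\phi(e)\in E(H)$ for every edge $e$ of $F$. The $s$-blowup $F(s)$ has vertices $x_1,\dots,x_s$ for each vertex $x$ of $F$, and for each edge $x^1\cdots x^k$ of $F$ all $s^k$ edges $x^1_{i_1}\cdots x^k_{i_k}$, $1\le i_j\le s$. The $s$-augmentation $F^{+s}$ is obtained from $F(s)$ by adding a set $V^+$ of $k-s$ new vertices and all edges $V^+\cup\{x_1,\dots,x_s\}$ for $x\in V(F)$. *)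

theory Defs
  imports Complex_Main "HOL-Library.FuncSet"
begin

definition kgraph :: "nat \<Rightarrow> 'a set \<Rightarrow> 'a set set \<Rightarrow> bool" where
  "kgraph k V E \<longleftrightarrow> finite V \<and> (\<forall>e\<in>E. e \<subseteq> V \<and> card e = k)"

definition hom_density :: "'b set \<Rightarrow> 'b set set \<Rightarrow> 'a set \<Rightarrow> 'a set set \<Rightarrow> real" where
  "hom_density VF EF VH EH =
     real (card {\<phi> \<in> VF \<rightarrow>\<^sub>E VH. \<forall>e\<in>EF. \<phi> ` e \<in> EH})
     / real (card VH) ^ card VF"

definition nbhd :: "'a set \<Rightarrow> 'a set set \<Rightarrow> 'a set \<Rightarrow> 'a set set" where
  "nbhd VH EH S = {T. T \<subseteq> VH - S \<and> S \<union> T \<in> EH}"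

definition graph_density :: "nat \<Rightarrow> nat \<Rightarrow> 'a set set \<Rightarrow> real" where
  "graph_density n s G = fact s * real (card G) / real n ^ s"

text \<open>The s-augmentation F^{+s} of a k-graph F.  The copies x_1..x_s of a vertex x
  are Inl (x,i) with i < s; the k-s new vertices V^+ are Inr j with j < k-s.\<close>
definition aug_V :: "nat \<Rightarrow> nat \<Rightarrow> 'b set \<Rightarrow> ('b \<times> nat + nat) set" where
  "aug_V k s VF = Inl ` (VF \<times> {..<s}) \<union> Inr ` {..<k - s}"

definition aug_E :: "nat \<Rightarrow> nat \<Rightarrow> 'b set \<Rightarrow> 'b set set \<Rightarrow> ('b \<times> nat + nat) set set" where
  "aug_E k s VF EF =
     {(\<lambda>x. Inl (x, f x)) ` e | e f. e \<in> EF \<and> f \<in> e \<rightarrow> {..<s}}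
     \<union> {Inr ` {..<k - s} \<union> Inl ` ({x} \<times> {..<s}) | x. x \<in> VF}"

end

theory Submission
  imports Defs
begin

text \<open>
  Write \<open>v\<close> for the number of vertices of \<open>F\<close>. For a tuple \<open>\<tau>\<close> of \<open>k - s\<close> vertices let
  \<open>G\<^sub>\<tau>\<close> be the set of \<open>s\<close>-tuples that complete \<open>\<tau>\<close> to an edge. An energy increment argument
  partitions \<open>X\<close> into boundedly many classes such that inside almost every class replacing a vertex
  by its class average does not affect weighted counts of partial blow-ups of \<open>F\<close>. On such a class
  \<open>D\<close> in which \<open>G\<^sub>\<tau>\<close> has positive density, one vertex of a copy of \<open>F\<close> can be replaced by a
  whole \<open>s\<close>-tuple of \<open>G\<^sub>\<tau>\<close> inside \<open>D\<close>, at the cost of a constant factor that depends on the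
  number of classes.

  The cost forces each of the \<open>v\<close> replacements to use its own, much more regular partition. So fix
  a sequence of \<open>L\<close> ever more regular partitions with \<open>L\<close> much larger than \<open>v\<close>, and let
  \<open>Z\<^sub>\<tau>\<close> consist of the vertices whose class is large and dense in \<open>G\<^sub>\<tau>\<close> for at least \<open>v\<close> of
  them. The vertices of any copy of \<open>F\<close> in \<open>Z\<^sub>\<tau>\<close> can be assigned distinct partitions, and the
  replacements are performed in increasing order of regularity: many copies of \<open>F\<close> in \<open>Z\<^sub>\<tau>\<close> give
  many copies of the augmentation through \<open>\<tau>\<close>. Since almost all \<open>s\<close>-sets have degree at least
  \<open>\<delta>\<close>, the average of \<open>|Z\<^sub>\<tau>|\<close> over \<open>\<tau>\<close> is at least about \<open>\<delta>n\<close>, while few \<open>\<tau>\<close> lie in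
  many copies of the augmentation.
\<close>

section \<open>Regular colourings\<close>

text \<open>A partition is encoded as a colouring by natural numbers. Splitting a class then means
  replacing colour \<open>j\<close> by \<open>2 * j\<close> and \<open>2 * j + 1\<close>, and a
  bound on the colours bounds the number of classes.\<close>

definition colour_class :: "('a \<Rightarrow> nat) \<Rightarrow> 'a set \<Rightarrow> nat \<Rightarrow> 'a set" where
  "colour_class c X j = {x \<in> X. c x = j}"

definition class_mean :: "('a \<Rightarrow> nat) \<Rightarrow> 'a set \<Rightarrow> ('a \<Rightarrow> real) \<Rightarrow> nat \<Rightarrow> real" where
  "class_mean c X g j = (\<Sum>y\<in>colour_class c X j. g y) / real (card (colour_class c X j))"

text \<open>The weight \<open>w\<close> may depend on the class; this is what allows the products of several fibres
  over the same class to be compared with powers of the class mean.\<close>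

definition irregular ::
    "('a \<Rightarrow> nat) \<Rightarrow> 'a set \<Rightarrow> 'u set \<Rightarrow> ('u \<Rightarrow> 'a \<Rightarrow> real) \<Rightarrow> real \<Rightarrow> nat \<Rightarrow> bool" where
  "irregular c X U f \<eta> j \<longleftrightarrow> (\<exists>w. (\<forall>u\<in>U. 0 \<le> w u \<and> w u \<le> 1) \<and>
     \<eta> * real (card (colour_class c X j)) * real (card U)
       < (\<Sum>x\<in>colour_class c X j. \<bar>\<Sum>u\<in>U. w u * (f u x - class_mean c X (f u) j)\<bar>))"

text \<open>The potential of the refinement argument: the squared L2 norm of the class means, summed
  over all functions of the family. For functions with values in [0,1] it lies between 0 and
  \<open>card X * card U\<close>.\<close>

definition energy :: "('a \<Rightarrow> nat) \<Rightarrow> 'a set \<Rightarrow> 'u set \<Rightarrow> ('u \<Rightarrow> 'a \<Rightarrow> real) \<Rightarrow> real" where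
  "energy c X U f = (\<Sum>u\<in>U. \<Sum>x\<in>X. (class_mean c X (f u) (c x))\<^sup>2)"

lemma sum_colour_classes:
  fixes g :: "'a \<Rightarrow> real"
  assumes "finite X"
  shows "(\<Sum>x\<in>X. g x) = (\<Sum>j\<in>c ` X. \<Sum>x\<in>colour_class c X j. g x)"
  unfolding colour_class_def by (rule sum.image_gen[OF assms])

text \<open>Taking class means is the orthogonal projection onto the functions of the colour: a
  coefficient that depends only on \<open>c x\<close> cannot distinguish \<open>g\<close> from its
  mean.\<close>

lemma sum_class_mean:
  assumes "finite X"
  shows "(\<Sum>x\<in>X. \<phi> (c x) * class_mean c X g (c x)) = (\<Sum>x\<in>X. \<phi> (c x) * g x)"
proof -
  have "(\<Sum>x\<in>colour_class c X j. \<phi> (c x) * class_mean c X g (c x))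
      = (\<Sum>x\<in>colour_class c X j. \<phi> (c x) * g x)" if j: "j \<in> c ` X" for j
  proof -
    have ne: "card (colour_class c X j) \<noteq> 0"
      using j assms by (auto simp: colour_class_def)
    have "(\<Sum>x\<in>colour_class c X j. \<phi> (c x) * class_mean c X g (c x))
        = (\<Sum>x\<in>colour_class c X j. \<phi> j * class_mean c X g j)"
      by (intro sum.cong) (auto simp: colour_class_def)
    also have "\<dots> = \<phi> j * (\<Sum>y\<in>colour_class c X j. g y)"
      using ne by (simp add: class_mean_def)
    also have "\<dots> = (\<Sum>x\<in>colour_class c X j. \<phi> (c x) * g x)"
      unfolding sum_distrib_left by (intro sum.cong) (auto simp: colour_class_def)
    finally show ?thesis .
  qed
  then show ?thesis
    unfolding sum_colour_classes[OF assms, of _ c] by (rule sum.cong[OF refl])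
qed

lemma class_mean_bounds:
  assumes "finite X" "\<And>x. x \<in> X \<Longrightarrow> 0 \<le> g x \<and> g x \<le> 1"
  shows "0 \<le> class_mean c X g j" "class_mean c X g j \<le> 1"
proof -
  have "(\<Sum>y\<in>colour_class c X j. g y) \<le> (\<Sum>y\<in>colour_class c X j. 1)"
    using assms by (intro sum_mono) (auto simp: colour_class_def)
  then show "class_mean c X g j \<le> 1"
    unfolding class_mean_def by (simp add: divide_le_eq)
  show "0 \<le> class_mean c X g j"
    unfolding class_mean_def using assms
    by (intro divide_nonneg_nonneg sum_nonneg) (auto simp: colour_class_def)
qed

text \<open>Pythagoras. Since \<open>c\<close> factors through \<open>c'\<close>, the coarse mean is
  the projection of the fine one, so the cross term equals the coarse energy.\<close>

lemma energy_diff: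
  assumes "finite X" and r: "\<And>x. x \<in> X \<Longrightarrow> c x = r (c' x)"
  shows "(\<Sum>u\<in>U. \<Sum>x\<in>X. (class_mean c' X (f u) (c' x) - class_mean c X (f u) (c x))\<^sup>2)
       = energy c' X U f - energy c X U f"
proof -
  have "(\<Sum>x\<in>X. (class_mean c' X (f u) (c' x) - class_mean c X (f u) (c x))\<^sup>2)
      = (\<Sum>x\<in>X. (class_mean c' X (f u) (c' x))\<^sup>2) - (\<Sum>x\<in>X. (class_mean c X (f u) (c x))\<^sup>2)" for u
  proof -
    let ?h = "class_mean c X (f u)" and ?h' = "class_mean c' X (f u)"
    have "(\<Sum>x\<in>X. ?h (c x) * ?h' (c' x)) = (\<Sum>x\<in>X. ?h (r (c' x)) * ?h' (c' x))"
      using r by (intro sum.cong) auto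
    also have "\<dots> = (\<Sum>x\<in>X. ?h (r (c' x)) * f u x)"
      by (rule sum_class_mean[OF assms(1), of "\<lambda>j. ?h (r j)" c' "f u"])
    also have "\<dots> = (\<Sum>x\<in>X. ?h (c x) * f u x)"
      using r by (intro sum.cong) auto
    also have "\<dots> = (\<Sum>x\<in>X. (?h (c x))\<^sup>2)"
      using sum_class_mean[OF assms(1), of ?h c "f u"] by (simp add: power2_eq_square)
    finally have cross: "(\<Sum>x\<in>X. ?h (c x) * ?h' (c' x)) = (\<Sum>x\<in>X. (?h (c x))\<^sup>2)" .
    have "(\<Sum>x\<in>X. (?h' (c' x) - ?h (c x))\<^sup>2)
        = (\<Sum>x\<in>X. (?h' (c' x))\<^sup>2 + (?h (c x))\<^sup>2 - 2 * (?h (c x) * ?h' (c' x)))"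
      by (intro sum.cong) (auto simp: power2_diff)
    also have "\<dots> = (\<Sum>x\<in>X. (?h' (c' x))\<^sup>2) + (\<Sum>x\<in>X. (?h (c x))\<^sup>2) - 2 * (\<Sum>x\<in>X. ?h (c x) * ?h' (c' x))"
      by (simp add: sum.distrib sum_subtractf sum_distrib_left)
    finally show ?thesis using cross by simp
  qed
  then show ?thesis by (simp add: energy_def sum_subtractf)
qed

text \<open>In an irregular class one weight \<open>w\<close> serves all \<open>u\<close> at once,
  so a single split of each class, by the sign of the weighted discrepancy, exposes the irregularity
  to the new means. This is why the number of colours only doubles, however large \<open>U\<close>
  is.\<close>

lemma energy_increment:
  assumes fin: "finite X" "finite U" and eta: "\<eta> > 0"
    and bad: "real (card {x \<in> X. irregular c X U f \<eta> (c x)}) > \<eta> * real (card X)"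
    and N: "\<And>x. x \<in> X \<Longrightarrow> c x < N"
  shows "\<exists>c'. (\<forall>x\<in>X. c' x < 2 * N) \<and>
    energy c' X U f \<ge> energy c X U f + \<eta> ^ 4 * real (card X) * real (card U)"
proof -
  define irr where "irr = irregular c X U f \<eta>"
  have "\<forall>j. \<exists>w. (\<forall>u\<in>U. 0 \<le> w u \<and> w u \<le> 1) \<and> (irr j \<longrightarrow>
     \<eta> * real (card (colour_class c X j)) * real (card U)
       < (\<Sum>x\<in>colour_class c X j. \<bar>\<Sum>u\<in>U. w u * (f u x - class_mean c X (f u) j)\<bar>))"
    (is "\<forall>j. \<exists>w. ?P j w")
  proof
    fix j
    show "\<exists>w. ?P j w"
    proof (cases "irr j")
      case True
      then show ?thesis unfolding irr_def irregular_def by blast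
    next
      case False
      then show ?thesis by (intro exI[of _ "\<lambda>_. 0"]) auto
    qed
  qed
  from choice[OF this] obtain w where w: "\<forall>j. ?P j (w j)" ..
  then have w01: "\<And>j u. u \<in> U \<Longrightarrow> 0 \<le> w j u \<and> w j u \<le> 1"
    and w: "\<And>j. irr j \<Longrightarrow> \<eta> * real (card (colour_class c X j)) * real (card U)
       < (\<Sum>x\<in>colour_class c X j. \<bar>\<Sum>u\<in>U. w j u * (f u x - class_mean c X (f u) j)\<bar>)"
    by auto
  \<comment> \<open>Each class is split according to the sign of its discrepancy \<open>D\<close>.\<close>
  define D where "D x = (\<Sum>u\<in>U. w (c x) u * (f u x - class_mean c X (f u) (c x)))" for x
  define c' where "c' x = 2 * c x + (if D x \<ge> 0 then 1 else 0)" for x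
  define sg where "sg j = (if odd j then 1 else -1 :: real)" for j :: nat
  define d where "d u x = class_mean c' X (f u) (c' x) - class_mean c X (f u) (c x)" for u x
  have c'2: "c' x div 2 = c x" for x by (auto simp: c'_def)
  have sgD: "sg (c' x) * D x = \<bar>D x\<bar>" for x by (auto simp: sg_def c'_def)
  let ?nU = "real (card X) * real (card U)"

  \<comment> \<open>Irregular classes cover more than an \<eta> share of \<open>X\<close>, and the
    mean of \<open>\<bar>D x\<bar>\<close> over each of them exceeds
    \<open>\<eta> * card U\<close>.\<close>
  have "\<eta> * \<eta> * ?nU \<le> \<eta> * real (card U) * real (card {x \<in> X. irr (c x)})"
    using mult_left_mono[OF less_imp_le[OF bad], of "\<eta> * real (card U)"] eta
    by (simp add: irr_def mult_ac)
  also have "\<dots> = (\<Sum>x\<in>X. if irr (c x) then \<eta> * real (card U) else 0)"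
    using fin by (simp add: sum.inter_filter[symmetric])
  also have "\<dots> \<le> (\<Sum>x\<in>X. \<bar>D x\<bar>)"
  proof -
    have "(\<Sum>x\<in>colour_class c X j. if irr (c x) then \<eta> * real (card U) else 0)
        \<le> (\<Sum>x\<in>colour_class c X j. \<bar>D x\<bar>)" for j
    proof (cases "irr j")
      case True
      have "(\<Sum>x\<in>colour_class c X j. if irr (c x) then \<eta> * real (card U) else 0)
          = (\<Sum>x\<in>colour_class c X j. \<eta> * real (card U))"
        using True by (intro sum.cong) (auto simp: colour_class_def)
      also have "\<dots> \<le> (\<Sum>x\<in>colour_class c X j. \<bar>\<Sum>u\<in>U. w j u * (f u x - class_mean c X (f u) j)\<bar>)"
        using w[OF True] by (simp add: mult_ac)
      also have "\<dots> = (\<Sum>x\<in>colour_class c X j. \<bar>D x\<bar>)"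
        by (intro sum.cong) (auto simp: colour_class_def D_def)
      finally show ?thesis .
    next
      case False
      then have "(\<Sum>x\<in>colour_class c X j. if irr (c x) then \<eta> * real (card U) else 0) = 0"
        by (intro sum.neutral) (auto simp: colour_class_def)
      then show ?thesis by (simp add: sum_nonneg)
    qed
    then show ?thesis
      unfolding sum_colour_classes[OF fin(1), of _ c] by (rule sum_mono)
  qed
  also have "\<dots> = (\<Sum>x\<in>X. \<Sum>u\<in>U. (sg (c' x) * w (c' x div 2) u) * (f u x - class_mean c X (f u) (c' x div 2)))"
    unfolding sgD[symmetric] by (simp add: D_def c'2 sum_distrib_left mult_ac)
  also have "\<dots> = (\<Sum>u\<in>U. \<Sum>x\<in>X. (sg (c' x) * w (c' x div 2) u) * (f u x - class_mean c X (f u) (c' x div 2)))"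
    by (rule sum.swap)
  \<comment> \<open>The coefficient depends on \<open>x\<close> only through the new colour
    \<open>c' x\<close>, so \<open>f u x\<close> may be replaced by its new class mean. The
    discrepancy becomes a difference of two means.\<close>
  also have "\<dots> = (\<Sum>u\<in>U. \<Sum>x\<in>X. (sg (c' x) * w (c' x div 2) u) * d u x)"
  proof (rule sum.cong[OF refl])
    fix u
    show "(\<Sum>x\<in>X. (sg (c' x) * w (c' x div 2) u) * (f u x - class_mean c X (f u) (c' x div 2)))
        = (\<Sum>x\<in>X. (sg (c' x) * w (c' x div 2) u) * d u x)"
      using sum_class_mean[OF fin(1), of "\<lambda>j. sg j * w (j div 2) u" c' "f u"]
      by (simp add: d_def right_diff_distrib sum_subtractf c'2)
  qed
  \<comment> \<open>The inequality of arithmetic and geometric means, balanced so that the constant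
    term uses up exactly half of the lower bound \<open>\<eta> * \<eta> * ?nU\<close>; the other
    half is left for the energy gain.\<close>
  also have "\<dots> \<le> (\<Sum>u\<in>U. \<Sum>x\<in>X. (d u x)\<^sup>2 / (2 * \<eta>\<^sup>2) + \<eta>\<^sup>2 / 2)"
  proof (intro sum_mono)
    fix u x assume u: "u \<in> U"
    have "(sg (c' x) * w (c' x div 2) u) * d u x \<le> \<bar>sg (c' x) * w (c' x div 2) u\<bar> * \<bar>d u x\<bar>"
      by (metis abs_ge_self abs_mult)
    also have "\<dots> \<le> 1 * \<bar>d u x\<bar>"
      using w01[OF u] by (intro mult_right_mono) (auto simp: sg_def)
    also have "\<dots> \<le> (d u x)\<^sup>2 / (2 * \<eta>\<^sup>2) + \<eta>\<^sup>2 / 2"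
    proof -
      have "0 \<le> (\<bar>d u x\<bar> - \<eta>\<^sup>2)\<^sup>2" by simp
      then have "2 * \<eta>\<^sup>2 * \<bar>d u x\<bar> \<le> (d u x)\<^sup>2 + \<eta>\<^sup>2 * \<eta>\<^sup>2"
        by (simp add: power2_diff power2_eq_square[of "\<eta>\<^sup>2"] mult_ac)
      then show ?thesis using eta by (simp add: field_simps power2_eq_square)
    qed
    finally show "(sg (c' x) * w (c' x div 2) u) * d u x \<le> (d u x)\<^sup>2 / (2 * \<eta>\<^sup>2) + \<eta>\<^sup>2 / 2" .
  qed
  also have "\<dots> = (energy c' X U f - energy c X U f) / (2 * \<eta>\<^sup>2) + \<eta>\<^sup>2 / 2 * ?nU"
    unfolding energy_diff[where X = X and c = c and r = "\<lambda>j. j div 2" and c' = c' and U = U and f = f, OF fin(1) c'2[symmetric], symmetric]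
    by (simp add: d_def sum.distrib sum_divide_distrib)
  finally have "\<eta>\<^sup>2 / 2 * ?nU \<le> (energy c' X U f - energy c X U f) / (2 * \<eta>\<^sup>2)"
    by (simp add: power2_eq_square field_simps)
  then have "(\<eta>\<^sup>2 / 2 * ?nU) * (2 * \<eta>\<^sup>2) \<le> energy c' X U f - energy c X U f"
    using eta by (subst (asm) pos_le_divide_eq) auto
  moreover have "(\<eta>\<^sup>2 / 2 * ?nU) * (2 * \<eta>\<^sup>2) = \<eta> ^ 4 * real (card X) * real (card U)"
    by (simp add: power2_eq_square power4_eq_xxxx)
  moreover have "\<forall>x\<in>X. c' x < 2 * N" using N by (force simp: c'_def)
  ultimately show ?thesis by (intro exI[of _ c'] conjI) (assumption | linarith)+
qed

text \<open>Each unsuccessful round gains at least an \<open>\<eta> ^ 4\<close> share of the maximal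
  energy \<open>card X * card U\<close>, so success comes within \<open>K\<close> rounds, each of
  which doubles the colours. The bound \<open>2 ^ K\<close> depends neither on \<open>X\<close> nor
  on \<open>U\<close>.\<close>

lemma regular_colouring_exists:
  fixes f :: "'u \<Rightarrow> 'a \<Rightarrow> real"
  assumes fin: "finite X" "finite U" and ne: "X \<noteq> {}" "U \<noteq> {}" and eta: "\<eta> > 0"
    and f: "\<And>u x. u \<in> U \<Longrightarrow> x \<in> X \<Longrightarrow> 0 \<le> f u x \<and> f u x \<le> 1"
    and K: "real K * \<eta> ^ 4 > 1"
  shows "\<exists>c. (\<forall>x\<in>X. c x < 2 ^ K) \<and>
    real (card {x \<in> X. irregular c X U f \<eta> (c x)}) \<le> \<eta> * real (card X)"
proof -
  let ?reg = "\<lambda>c. real (card {x \<in> X. irregular c X U f \<eta> (c x)}) \<le> \<eta> * real (card X)"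
  let ?nU = "real (card X) * real (card U)"
  have step: "(\<exists>c k. k \<le> m \<and> (\<forall>x\<in>X. c x < 2 ^ k) \<and> ?reg c) \<or>
     (\<exists>c. (\<forall>x\<in>X. c x < 2 ^ m) \<and> energy c X U f \<ge> real m * \<eta> ^ 4 * ?nU)" for m
  proof (induction m)
    case 0
    show ?case by (rule disjI2, rule exI[of _ "\<lambda>_. 0"]) (simp add: energy_def sum_nonneg)
  next
    case (Suc m)
    then show ?case
    proof
      assume "\<exists>c k. k \<le> m \<and> (\<forall>x\<in>X. c x < 2 ^ k) \<and> ?reg c"
      then show ?thesis using le_SucI by blast
    next
      assume "\<exists>c. (\<forall>x\<in>X. c x < 2 ^ m) \<and> energy c X U f \<ge> real m * \<eta> ^ 4 * ?nU"
      then obtain c where c: "\<forall>x\<in>X. c x < 2 ^ m" "energy c X U f \<ge> real m * \<eta> ^ 4 * ?nU" by blast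
      show ?thesis
      proof (cases "?reg c")
        case True
        then show ?thesis using c by (intro disjI1) (auto intro!: exI[of _ c] exI[of _ m])
      next
        case False
        then obtain c' where "\<forall>x\<in>X. c' x < 2 * 2 ^ m"
          "energy c' X U f \<ge> energy c X U f + \<eta> ^ 4 * real (card X) * real (card U)"
          using energy_increment[OF fin eta, of c f "2 ^ m"] c by force
        then show ?thesis using c
          by (intro disjI2 exI[of _ c']) (auto simp: algebra_simps)
      qed
    qed
  qed
  from step[of K] show ?thesis
  proof
    assume "\<exists>c k. k \<le> K \<and> (\<forall>x\<in>X. c x < 2 ^ k) \<and> ?reg c"
    then obtain c k where c: "k \<le> K" "\<forall>x\<in>X. c x < 2 ^ k" "?reg c" by blast
    have "(2::nat) ^ k \<le> 2 ^ K" using c(1) by (simp add: power_increasing)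
    then show ?thesis using c by (intro exI[of _ c]) (auto intro: less_le_trans)
  next
    assume "\<exists>c. (\<forall>x\<in>X. c x < 2 ^ K) \<and> energy c X U f \<ge> real K * \<eta> ^ 4 * ?nU"
    then obtain c where c: "energy c X U f \<ge> real K * \<eta> ^ 4 * ?nU" by blast
    have "energy c X U f \<le> (\<Sum>u\<in>U. \<Sum>x\<in>X. 1)"
      unfolding energy_def
    proof (intro sum_mono)
      fix u x assume u: "u \<in> U"
      show "(class_mean c X (f u) (c x))\<^sup>2 \<le> 1"
        using class_mean_bounds[OF fin(1), of "f u" c "c x"] f[OF u] by (simp add: power_le_one)
    qed
    then have "energy c X U f \<le> 1 * ?nU" by (simp add: mult.commute)
    moreover have "?nU > 0" using fin ne by (simp add: card_gt_0_iff)
    then have "1 * ?nU < real K * \<eta> ^ 4 * ?nU" using K by (intro mult_strict_right_mono) auto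
    ultimately show ?thesis using c by linarith
  qed
qed

section \<open>Replacing a vertex by a tuple inside one class\<close>

lemma sum_PiE_insert:
  fixes F :: "('i \<Rightarrow> 'a) \<Rightarrow> real"
  assumes "i \<notin> S"
  shows "(\<Sum>q\<in>PiE (insert i S) T. F q) = (\<Sum>g\<in>PiE S T. \<Sum>y\<in>T i. F (g(i := y)))"
proof -
  have "(\<Sum>q\<in>PiE (insert i S) T. F q) = (\<Sum>(y, g)\<in>T i \<times> PiE S T. F (g(i := y)))"
    unfolding PiE_insert_eq using inj_combinator[OF assms, of T]
    by (subst sum.reindex) (auto simp: case_prod_unfold o_def intro!: sum.cong)
  also have "\<dots> = (\<Sum>y\<in>T i. \<Sum>g\<in>PiE S T. F (g(i := y)))"
    by (rule sum.cartesian_product[symmetric])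
  also have "\<dots> = (\<Sum>g\<in>PiE S T. \<Sum>y\<in>T i. F (g(i := y)))"
    by (rule sum.swap)
  finally show ?thesis .
qed

text \<open>The factors are exchanged for class means one at a time, at a cost of \<eta> each. While
  one coordinate varies, the product over the fixed coordinates acts as part of the weight; this is
  what the arbitrary weight in \<open>irregular\<close> is for.\<close>

lemma regular_class_power:
  fixes f :: "'u \<Rightarrow> 'a \<Rightarrow> real"
  assumes fin: "finite X" "finite U"
    and f: "\<And>u x. u \<in> U \<Longrightarrow> x \<in> X \<Longrightarrow> 0 \<le> f u x \<and> f u x \<le> 1"
    and reg: "\<not> irregular c X U f \<eta> j"
    and w: "\<And>u. u \<in> U \<Longrightarrow> 0 \<le> w u \<and> w u \<le> 1"
  shows "(\<Sum>q\<in>{..<m} \<rightarrow>\<^sub>E colour_class c X j.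
      \<bar>(\<Sum>u\<in>U. w u * (\<Prod>b<m. f u (q b))) - (\<Sum>u\<in>U. w u * class_mean c X (f u) j ^ m)\<bar>)
    \<le> real m * \<eta> * real (card (colour_class c X j)) ^ m * real (card U)"
  using w
proof (induction m arbitrary: w)
  case 0
  then show ?case by simp
next
  case (Suc m)
  let ?C = "colour_class c X j" and ?h = "\<lambda>u. class_mean c X (f u) j"
  let ?P = "\<lambda>q u. \<Prod>b<m. f u (q b)"
  have CX: "?C \<subseteq> X" by (auto simp: colour_class_def)
  have P01: "0 \<le> ?P q u \<and> ?P q u \<le> 1" if "q \<in> {..<m} \<rightarrow>\<^sub>E ?C" "u \<in> U" for q u
  proof -
    have "0 \<le> f u (q b) \<and> f u (q b) \<le> 1" if b: "b \<in> {..<m}" for b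
      using f[OF \<open>u \<in> U\<close>] CX PiE_mem[OF \<open>q \<in> {..<m} \<rightarrow>\<^sub>E ?C\<close> b] by blast
    then show ?thesis by (auto intro!: prod_nonneg prod_le_1)
  qed
  have h01: "0 \<le> ?h u \<and> ?h u \<le> 1" if "u \<in> U" for u
    using class_mean_bounds[OF fin(1), of "f u"] f[OF that] by blast
  have new: "(\<Sum>y\<in>?C. \<bar>\<Sum>u\<in>U. (w u * ?P q u) * (f u y - ?h u)\<bar>) \<le> \<eta> * real (card ?C) * real (card U)"
    if q: "q \<in> {..<m} \<rightarrow>\<^sub>E ?C" for q
  proof -
    have "\<forall>u\<in>U. 0 \<le> w u * ?P q u \<and> w u * ?P q u \<le> 1"
      using Suc.prems P01[OF q] by (auto intro!: mult_le_one mult_nonneg_nonneg)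
    then show ?thesis
      using reg unfolding irregular_def by (auto simp: not_less dest!: spec[of _ "\<lambda>u. w u * ?P q u"])
  qed
  have wh: "0 \<le> w u * ?h u \<and> w u * ?h u \<le> 1" if "u \<in> U" for u
    using Suc.prems[OF that] h01[OF that] by (auto intro!: mult_le_one)
  \<comment> \<open>The first term exchanges the last factor for its mean. The mean is then absorbed
    into the weight, and the second term is the induction hypothesis for the weight
    \<open>w u * ?h u\<close>.\<close>
  have split: "\<bar>(\<Sum>u\<in>U. w u * (?P q u * f u y)) - (\<Sum>u\<in>U. w u * ?h u ^ Suc m)\<bar>
      \<le> \<bar>\<Sum>u\<in>U. (w u * ?P q u) * (f u y - ?h u)\<bar>
        + \<bar>(\<Sum>u\<in>U. (w u * ?h u) * ?P q u) - (\<Sum>u\<in>U. (w u * ?h u) * ?h u ^ m)\<bar>" for q y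
  proof -
    have "(\<Sum>u\<in>U. w u * (?P q u * f u y)) - (\<Sum>u\<in>U. w u * ?h u ^ Suc m)
        = (\<Sum>u\<in>U. (w u * ?P q u) * (f u y - ?h u))
          + ((\<Sum>u\<in>U. (w u * ?h u) * ?P q u) - (\<Sum>u\<in>U. (w u * ?h u) * ?h u ^ m))"
      unfolding sum_subtractf[symmetric] sum.distrib[symmetric]
      by (intro sum.cong) (auto simp: algebra_simps)
    then show ?thesis by (simp only: abs_triangle_ineq)
  qed
  have "(\<Sum>q\<in>{..<Suc m} \<rightarrow>\<^sub>E ?C.
      \<bar>(\<Sum>u\<in>U. w u * (\<Prod>b<Suc m. f u (q b))) - (\<Sum>u\<in>U. w u * ?h u ^ Suc m)\<bar>)
    = (\<Sum>q\<in>{..<m} \<rightarrow>\<^sub>E ?C. \<Sum>y\<in>?C.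
        \<bar>(\<Sum>u\<in>U. w u * (?P q u * f u y)) - (\<Sum>u\<in>U. w u * ?h u ^ Suc m)\<bar>)"
    unfolding lessThan_Suc by (subst sum_PiE_insert) (auto intro!: sum.cong prod.cong simp: mult.commute)
  also have "\<dots> \<le> (\<Sum>q\<in>{..<m} \<rightarrow>\<^sub>E ?C. \<Sum>y\<in>?C. \<bar>\<Sum>u\<in>U. (w u * ?P q u) * (f u y - ?h u)\<bar>
        + \<bar>(\<Sum>u\<in>U. (w u * ?h u) * ?P q u) - (\<Sum>u\<in>U. (w u * ?h u) * ?h u ^ m)\<bar>)"
    by (intro sum_mono split)
  also have "\<dots> = (\<Sum>q\<in>{..<m} \<rightarrow>\<^sub>E ?C. (\<Sum>y\<in>?C. \<bar>\<Sum>u\<in>U. (w u * ?P q u) * (f u y - ?h u)\<bar>))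
      + real (card ?C) * (\<Sum>q\<in>{..<m} \<rightarrow>\<^sub>E ?C.
          \<bar>(\<Sum>u\<in>U. (w u * ?h u) * ?P q u) - (\<Sum>u\<in>U. (w u * ?h u) * ?h u ^ m)\<bar>)"
    by (simp add: sum.distrib sum_distrib_left)
  also have "\<dots> \<le> (\<Sum>q\<in>{..<m} \<rightarrow>\<^sub>E ?C. \<eta> * real (card ?C) * real (card U))
      + real (card ?C) * (real m * \<eta> * real (card ?C) ^ m * real (card U))"
    using wh by (intro add_mono sum_mono mult_left_mono Suc.IH new) auto
  also have "\<dots> = real (Suc m) * \<eta> * real (card ?C) ^ Suc m * real (card U)"
    by (simp add: card_funcsetE algebra_simps)
  finally show ?case .
qed

text \<open>For \<open>a \<le> t\<close> the right-hand side is not positive; otherwise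
  \<open>a ^ m\<close> dominates \<open>t ^ m\<close>. The lower bound is affine in
  \<open>a\<close>, so it can be summed and takes the place of a convexity inequality.\<close>

lemma power_ge_chord:
  fixes a t :: real
  assumes "a \<ge> 0" "t \<ge> 0"
  shows "a ^ Suc m \<ge> t ^ m * (a - t)"
proof (cases "a \<le> t")
  case True
  have "t ^ m * (a - t) \<le> 0" using True assms by (intro mult_nonneg_nonpos) auto
  also have "0 \<le> a ^ Suc m" using assms by simp
  finally show ?thesis .
next
  case False
  have "t ^ m * (a - t) \<le> a ^ m * a"
    using False assms by (intro mult_mono power_mono) auto
  then show ?thesis by (simp add: mult.commute)
qed

text \<open>Averaging over classes yields a regular class \<open>D\<close> with property
  \<open>P\<close> on which the weighted mean is at least \<open>\<gamma> / 2\<close>. There the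
  count of a tuple is L1-close to a constant. The tuples in \<open>G\<close> have density at least
  \<epsilon> in \<open>D\<close>, so they carry their share of the count once the total error is
  below half of the main term.\<close>

lemma column_step:
  fixes f :: "'u \<Rightarrow> 'a \<Rightarrow> real" and X :: "'a set" and c :: "'a \<Rightarrow> nat"
  defines "C \<equiv> colour_class c X"
  assumes fin: "finite X" "finite U" and ne: "X \<noteq> {}" "U \<noteq> {}"
    and s: "s \<ge> 1" and pos: "\<gamma> > 0" "\<rho> \<ge> 0" "\<epsilon> \<ge> 0" "\<eta> \<ge> 0"
    and f: "\<And>u x. u \<in> U \<Longrightarrow> x \<in> X \<Longrightarrow> 0 \<le> f u x \<and> f u x \<le> 1"
    and w: "\<And>u. u \<in> U \<Longrightarrow> 0 \<le> w u \<and> w u \<le> 1"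
    and reg: "real (card {x \<in> X. irregular c X U f \<eta> (c x)}) \<le> \<eta> * real (card X)"
    and eta: "\<eta> \<le> \<gamma> / 4" "real s * \<eta> \<le> \<epsilon> * (\<gamma> / 4) ^ s / 2"
    and big: "\<And>x. x \<in> X \<Longrightarrow> P (c x) \<Longrightarrow> \<rho> * real (card X) \<le> real (card (C (c x)))"
    and dense: "\<And>x. x \<in> X \<Longrightarrow> P (c x) \<Longrightarrow>
        \<epsilon> * real (card (C (c x))) ^ s \<le> real (card {q \<in> {..<s} \<rightarrow>\<^sub>E C (c x). G q})"
    and lower: "(\<Sum>y | y \<in> X \<and> P (c y). \<Sum>u\<in>U. w u * f u y) \<ge> \<gamma> * real (card X) * real (card U)"
  shows "(\<Sum>q | q \<in> {..<s} \<rightarrow>\<^sub>E X \<and> G q. \<Sum>u\<in>U. w u * (\<Prod>b<s. f u (q b)))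
      \<ge> \<rho> ^ s * (\<epsilon> * (\<gamma> / 4) ^ s / 2) * real (card X) ^ s * real (card U)"
proof -
  let ?n = "real (card X)" and ?U = "real (card U)"
  have n0: "?n > 0" and U0: "?U > 0" using fin ne by (auto simp: card_gt_0_iff)
  define h where "h j u = class_mean c X (f u) j" for j u
  have h01: "0 \<le> h j u \<and> h j u \<le> 1" if "u \<in> U" for u j
    using class_mean_bounds[OF fin(1), of "f u"] f[OF that] unfolding h_def by blast
  define W where "W j = (\<Sum>u\<in>U. w u * h j u)" for j
  define irr where "irr = irregular c X U f \<eta>"
  have W01: "0 \<le> W j \<and> W j \<le> ?U" for j
  proof -
    have "W j \<le> (\<Sum>u\<in>U. 1)" unfolding W_def
      using w h01 by (intro sum_mono) (auto intro!: mult_le_one)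
    moreover have "0 \<le> W j" unfolding W_def
      using w h01 by (intro sum_nonneg) auto
    ultimately show ?thesis by simp
  qed
  have sumW: "(\<Sum>y | y \<in> X \<and> P (c y). W (c y)) = (\<Sum>y | y \<in> X \<and> P (c y). \<Sum>u\<in>U. w u * f u y)"
  proof -
    let ?\<phi> = "\<lambda>j. if P j then 1 else (0::real)"
    have "(\<Sum>y | y \<in> X \<and> P (c y). W (c y)) = (\<Sum>y\<in>X. ?\<phi> (c y) * W (c y))"
      using fin by (subst sum.inter_filter) (auto intro!: sum.cong)
    also have "\<dots> = (\<Sum>u\<in>U. w u * (\<Sum>y\<in>X. ?\<phi> (c y) * h (c y) u))"
      unfolding W_def sum_distrib_left by (subst sum.swap) (simp add: mult_ac)
    also have "\<dots> = (\<Sum>u\<in>U. w u * (\<Sum>y\<in>X. ?\<phi> (c y) * f u y))"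
      unfolding h_def by (subst sum_class_mean[OF fin(1), of ?\<phi>]) (rule refl)
    also have "\<dots> = (\<Sum>y\<in>X. ?\<phi> (c y) * (\<Sum>u\<in>U. w u * f u y))"
      unfolding sum_distrib_left by (subst sum.swap) (simp add: mult_ac)
    also have "\<dots> = (\<Sum>y | y \<in> X \<and> P (c y). \<Sum>u\<in>U. w u * f u y)"
      using fin by (subst sum.inter_filter) (auto intro!: sum.cong)
    finally show ?thesis .
  qed
  \<comment> \<open>Otherwise irregular classes contribute at most an
    \<open>\<eta> \<le> \<gamma> / 4\<close> share and the remaining ones at most a
    \<open>\<gamma> / 2\<close> share, short of the required \<gamma>.\<close>
  have "\<exists>x\<in>X. P (c x) \<and> \<not> irr (c x) \<and> W (c x) \<ge> \<gamma> / 2 * ?U"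
  proof (rule ccontr)
    assume neg: "\<not> ?thesis"
    have "(\<Sum>y | y \<in> X \<and> P (c y). W (c y))
        \<le> (\<Sum>y | y \<in> X \<and> P (c y). (if irr (c y) then ?U else 0) + \<gamma> / 2 * ?U)"
    proof (intro sum_mono)
      fix y assume "y \<in> {y. y \<in> X \<and> P (c y)}"
      then show "W (c y) \<le> (if irr (c y) then ?U else 0) + \<gamma> / 2 * ?U"
        using W01[of "c y"] neg pos U0 by (auto simp: not_le intro: less_imp_le add_increasing2)
    qed
    also have "\<dots> \<le> (\<Sum>y\<in>X. (if irr (c y) then ?U else 0) + \<gamma> / 2 * ?U)"
      using fin pos by (intro sum_mono2) auto
    also have "\<dots> = real (card {x \<in> X. irr (c x)}) * ?U + \<gamma> / 2 * ?U * ?n"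
      using fin by (simp add: sum.distrib sum.inter_filter[symmetric])
    also have "\<dots> \<le> (\<eta> * ?n) * ?U + \<gamma> / 2 * ?U * ?n"
      using reg unfolding irr_def by (intro add_mono mult_right_mono) auto
    also have "\<dots> \<le> (\<gamma> / 4 * ?n) * ?U + \<gamma> / 2 * ?U * ?n"
      using eta by (intro add_mono mult_right_mono) auto
    also have "\<dots> < \<gamma> * ?n * ?U"
    proof -
      have "\<gamma> * ?n * ?U > 0" using pos n0 U0 by simp
      then show ?thesis by (simp add: field_simps)
    qed
    finally show False using lower sumW by linarith
  qed
  then obtain x where x: "x \<in> X" "P (c x)" "\<not> irr (c x)" "W (c x) \<ge> \<gamma> / 2 * ?U" by blast
  define j where "j = c x"
  define D where "D = C j"
  let ?d = "real (card D)"
  have DX: "D \<subseteq> X" by (auto simp: D_def C_def colour_class_def)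
  have finD: "finite D" using DX fin finite_subset by blast
  define QD where "QD = {q \<in> {..<s} \<rightarrow>\<^sub>E D. G q}"
  have finQ: "finite ({..<s} \<rightarrow>\<^sub>E D)" "finite ({..<s} \<rightarrow>\<^sub>E X)" using finD fin by (auto intro!: finite_PiE)
  obtain m where m: "s = Suc m" using s by (cases s) auto
  \<comment> \<open>The chord inequality at \<open>t = \<gamma> / 4\<close>: subtracting this
    threshold from the mean \<open>\<gamma> / 2\<close> leaves another \<open>\<gamma> / 4\<close>.
    As \<open>w u \<le> 1\<close>, the power \<open>w u ^ s\<close> can be raised to the single
    factor \<open>w u\<close>.\<close>
  have main: "(\<Sum>u\<in>U. w u * h j u ^ s) \<ge> (\<gamma> / 4) ^ s * ?U"
  proof -
    have "(\<gamma> / 4) ^ s * ?U \<le> (\<gamma> / 4) ^ m * (W j - \<gamma> / 4 * ?U)"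
    proof -
      have "(\<gamma> / 4) ^ m * (\<gamma> / 4 * ?U) \<le> (\<gamma> / 4) ^ m * (W j - \<gamma> / 4 * ?U)"
        using x(4) pos unfolding j_def by (intro mult_left_mono) (auto simp: field_simps)
      then show ?thesis by (simp add: m mult_ac)
    qed
    also have "\<dots> = (\<Sum>u\<in>U. (\<gamma> / 4) ^ m * (w u * h j u - \<gamma> / 4))"
      by (simp add: W_def sum_subtractf sum_distrib_left[symmetric] mult_ac)
    also have "\<dots> \<le> (\<Sum>u\<in>U. w u * h j u ^ s)"
    proof (intro sum_mono)
      fix u assume u: "u \<in> U"
      have "(\<gamma> / 4) ^ m * (w u * h j u - \<gamma> / 4) \<le> (w u * h j u) ^ s"
        unfolding m using w[OF u] h01[OF u] pos by (intro power_ge_chord) auto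
      also have "\<dots> = w u ^ s * h j u ^ s" by (rule power_mult_distrib)
      also have "\<dots> \<le> w u * h j u ^ s"
        unfolding m using w[OF u] h01[OF u]
        by (intro mult_right_mono) (auto simp: mult_left_le power_le_one)
      finally show "(\<gamma> / 4) ^ m * (w u * h j u - \<gamma> / 4) \<le> w u * h j u ^ s" .
    qed
    finally show ?thesis .
  qed
  define V where "V q = (\<Sum>u\<in>U. w u * (\<Prod>b<s. f u (q b)))" for q
  define Vbar where "Vbar = (\<Sum>u\<in>U. w u * h j u ^ s)"
  have err: "(\<Sum>q\<in>{..<s} \<rightarrow>\<^sub>E D. \<bar>V q - Vbar\<bar>) \<le> real s * \<eta> * ?d ^ s * ?U"
    using regular_class_power[OF fin f x(3)[unfolded irr_def] w, where m = s]
    unfolding V_def Vbar_def h_def D_def C_def j_def by simp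
  have V0: "V q \<ge> 0" if "q \<in> {..<s} \<rightarrow>\<^sub>E X" for q
    unfolding V_def
  proof (intro sum_nonneg mult_nonneg_nonneg prod_nonneg)
    fix u b assume "u \<in> U" "b \<in> {..<s}"
    then show "0 \<le> f u (q b)" using f that by (auto dest: PiE_mem)
  qed (use w in auto)
  have "\<rho> ^ s * (\<epsilon> * (\<gamma> / 4) ^ s / 2) * ?n ^ s * ?U = (\<epsilon> * (\<gamma> / 4) ^ s / 2 * ?U) * (\<rho> * ?n) ^ s"
    by (simp add: power_mult_distrib)
  also have "\<dots> \<le> (\<epsilon> * (\<gamma> / 4) ^ s / 2 * ?U) * ?d ^ s"
    using big[OF x(1,2)] pos unfolding D_def j_def by (intro mult_left_mono power_mono) auto
  \<comment> \<open>Half of the main term is set aside here to pay for the regularity error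
    \<open>real s * \<eta>\<close>.\<close>
  also have "\<dots> = (\<epsilon> * ?d ^ s) * ((\<gamma> / 4) ^ s * ?U) - (\<epsilon> * (\<gamma> / 4) ^ s / 2) * ?d ^ s * ?U"
    by (simp add: field_simps)
  also have "\<dots> \<le> real (card QD) * Vbar - (real s * \<eta>) * ?d ^ s * ?U"
  proof (intro diff_mono mult_mono mult_right_mono)
    show "\<epsilon> * ?d ^ s \<le> real (card QD)"
      using dense[OF x(1,2)] unfolding QD_def D_def j_def by simp
  qed (use main eta pos in \<open>auto simp: Vbar_def\<close>)
  also have "\<dots> \<le> real (card QD) * Vbar - (\<Sum>q\<in>{..<s} \<rightarrow>\<^sub>E D. \<bar>V q - Vbar\<bar>)"
    using err by simp
  \<comment> \<open>\<open>QD\<close> need not be structured in any way: the error summed over all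
    tuples in \<open>D\<close> bounds the error on every subset.\<close>
  also have "\<dots> \<le> real (card QD) * Vbar - (\<Sum>q\<in>QD. \<bar>V q - Vbar\<bar>)"
    using finQ by (intro diff_mono sum_mono2) (auto simp: QD_def)
  also have "\<dots> = (\<Sum>q\<in>QD. Vbar - \<bar>V q - Vbar\<bar>)" by (simp add: sum_subtractf)
  also have "\<dots> \<le> (\<Sum>q\<in>QD. V q)" by (intro sum_mono) auto
  also have "\<dots> \<le> (\<Sum>q | q \<in> {..<s} \<rightarrow>\<^sub>E X \<and> G q. V q)"
    using finQ DX V0 PiE_mono[of "{..<s}" "\<lambda>_. D" "\<lambda>_. X"] by (intro sum_mono2) (auto simp: QD_def)
  finally show ?thesis unfolding V_def .
qed

section \<open>Blowing up copies column by column\<close>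

text \<open>The columns outside \<open>A\<close> are still single vertices, stored in entry \<open>0\<close>; their remaining
  entries are unconstrained, so that all partial blow-ups live in the same space.\<close>

definition transversals_in ::
    "(('b \<Rightarrow> 'a) \<Rightarrow> bool) \<Rightarrow> 'b set \<Rightarrow> nat \<Rightarrow> 'b set \<Rightarrow> ('b \<Rightarrow> nat \<Rightarrow> 'a) \<Rightarrow> bool" where
  "transversals_in R I s A \<psi> \<longleftrightarrow>
     (\<forall>g\<in>I \<rightarrow>\<^sub>E {..<s}. (\<forall>x\<in>I - A. g x = 0) \<longrightarrow> R (\<lambda>x\<in>I. \<psi> x (g x)))"

text \<open>As long as \<open>i\<close> lies outside \<open>A\<close>, the admissible choices
  \<open>g\<close> read only entry 0 of column \<open>i\<close>. With a constant column the
  condition becomes a function of one vertex.\<close>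

lemma transversals_in_upd_zero:
  assumes "i \<in> I" "i \<notin> A" "s \<ge> 1"
  shows "transversals_in R I s A (u(i := q))
     \<longleftrightarrow> transversals_in R I s A (u(i := \<lambda>_\<in>{..<s}. q 0))"
proof -
  have "(\<lambda>x\<in>I. (u(i := q)) x (g x)) = (\<lambda>x\<in>I. (u(i := \<lambda>_\<in>{..<s}. q 0)) x (g x))"
    if "\<forall>x\<in>I - A. g x = 0" for g
    using that assms by (auto simp: restrict_def fun_eq_iff)
  then show ?thesis unfolding transversals_in_def by (auto simp del: fun_upd_apply)
qed

text \<open>A transversal uses exactly one entry \<open>b\<close> of column \<open>i\<close>, and it
  sees the same vertices as if the column were constant with value \<open>q b\<close>. Hence the
  indicator after the replacement is a product over \<open>b\<close> of indicators before it, the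
  shape handled by \<open>regular_class_power\<close>.\<close>

lemma transversals_in_insert:
  assumes "i \<in> I" "i \<notin> A"
  shows "transversals_in R I s (insert i A) (u(i := q))
     \<longleftrightarrow> (\<forall>b<s. transversals_in R I s A (u(i := \<lambda>_\<in>{..<s}. q b)))"
proof (intro iffI allI impI)
  fix b assume b: "b < s" and *: "transversals_in R I s (insert i A) (u(i := q))"
  show "transversals_in R I s A (u(i := \<lambda>_\<in>{..<s}. q b))"
    unfolding transversals_in_def
  proof (intro ballI impI)
    fix g assume g: "g \<in> I \<rightarrow>\<^sub>E {..<s}" "\<forall>x\<in>I - A. g x = 0"
    have "g(i := b) \<in> I \<rightarrow>\<^sub>E {..<s}" using g(1) b assms
      by (auto simp: PiE_iff extensional_def)
    moreover have "\<forall>x\<in>I - insert i A. (g(i := b)) x = 0" using g(2) by auto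
    ultimately have "R (\<lambda>x\<in>I. (u(i := q)) x ((g(i := b)) x))"
      using * unfolding transversals_in_def by blast
    moreover have "(\<lambda>x\<in>I. (u(i := q)) x ((g(i := b)) x))
        = (\<lambda>x\<in>I. (u(i := \<lambda>_\<in>{..<s}. q b)) x (g x))"
      using g b assms by (auto simp: restrict_def fun_eq_iff)
    ultimately show "R (\<lambda>x\<in>I. (u(i := \<lambda>_\<in>{..<s}. q b)) x (g x))" by simp
  qed
next
  assume *: "\<forall>b<s. transversals_in R I s A (u(i := \<lambda>_\<in>{..<s}. q b))"
  show "transversals_in R I s (insert i A) (u(i := q))"
    unfolding transversals_in_def
  proof (intro ballI impI)
    fix g assume g: "g \<in> I \<rightarrow>\<^sub>E {..<s}" "\<forall>x\<in>I - insert i A. g x = 0"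
    have gi: "g i < s" using g(1) assms by auto
    have "g(i := 0) \<in> I \<rightarrow>\<^sub>E {..<s}" using g(1) gi assms
      by (auto simp: PiE_iff extensional_def)
    moreover have "\<forall>x\<in>I - A. (g(i := 0)) x = 0" using g(2) by auto
    ultimately have "R (\<lambda>x\<in>I. (u(i := \<lambda>_\<in>{..<s}. q (g i))) x ((g(i := 0)) x))"
      using * gi unfolding transversals_in_def by blast
    moreover have "(\<lambda>x\<in>I. (u(i := \<lambda>_\<in>{..<s}. q (g i))) x ((g(i := 0)) x))
        = (\<lambda>x\<in>I. (u(i := q)) x (g x))"
      using gi by (auto simp: restrict_def fun_eq_iff)
    ultimately show "R (\<lambda>x\<in>I. (u(i := q)) x (g x))" by simp
  qed
qed

lemma sum_PiE_zero:
  fixes F :: "'a \<Rightarrow> real"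
  assumes "s \<ge> 1"
  shows "(\<Sum>q\<in>{..<s} \<rightarrow>\<^sub>E X. F (q 0)) = real (card X ^ (s - 1)) * (\<Sum>y\<in>X. F y)"
proof -
  have "{..<s} = insert 0 {1..<s}" using assms by auto
  then show ?thesis by (simp add: sum_PiE_insert card_funcsetE)
qed

text \<open>The hypothesis says that \<open>\<pi>\<close> pushes counting on \<open>Q\<close> to
  \<kappa> times counting on \<open>X\<close>; the coordinates are independent, so each contributes
  one factor \<kappa>.\<close>

lemma sum_PiE_project:
  fixes F :: "('b \<Rightarrow> 'a) \<Rightarrow> real"
  assumes "finite I" and \<pi>: "\<And>F :: 'a \<Rightarrow> real. (\<Sum>q\<in>Q. F (\<pi> q)) = \<kappa> * (\<Sum>y\<in>X. F y)"
  shows "(\<Sum>\<psi>\<in>I \<rightarrow>\<^sub>E Q. F (\<lambda>x\<in>I. \<pi> (\<psi> x))) = \<kappa> ^ card I * (\<Sum>\<phi>\<in>I \<rightarrow>\<^sub>E X. F \<phi>)"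
  using assms(1)
proof (induction I arbitrary: F rule: finite_induct)
  case empty
  then show ?case by (simp add: restrict_def)
next
  case (insert i I)
  have upd: "(\<lambda>x\<in>insert i I. \<pi> ((u(i := q)) x)) = (\<lambda>x\<in>I. \<pi> (u x))(i := \<pi> q)" for u q
    using insert.hyps by (auto simp: restrict_def fun_eq_iff)
  have "(\<Sum>\<psi>\<in>insert i I \<rightarrow>\<^sub>E Q. F (\<lambda>x\<in>insert i I. \<pi> (\<psi> x)))
      = (\<Sum>u\<in>I \<rightarrow>\<^sub>E Q. \<Sum>q\<in>Q. F ((\<lambda>x\<in>I. \<pi> (u x))(i := \<pi> q)))"
    by (subst sum_PiE_insert[OF insert.hyps(2)]) (simp only: upd)
  also have "\<dots> = (\<Sum>u\<in>I \<rightarrow>\<^sub>E Q. \<kappa> * (\<Sum>y\<in>X. F ((\<lambda>x\<in>I. \<pi> (u x))(i := y))))"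
    by (subst \<pi>) (rule refl)
  also have "\<dots> = \<kappa> * (\<kappa> ^ card I * (\<Sum>\<phi>\<in>I \<rightarrow>\<^sub>E X. \<Sum>y\<in>X. F (\<phi>(i := y))))"
    unfolding sum_distrib_left[symmetric] by (subst insert.IH) (rule refl)
  also have "\<dots> = \<kappa> ^ card (insert i I) * (\<Sum>\<phi>\<in>insert i I \<rightarrow>\<^sub>E X. F \<phi>)"
    using insert.hyps by (simp add: sum_PiE_insert)
  finally show ?case .
qed

definition partial_blowups ::
    "(('b \<Rightarrow> 'a) \<Rightarrow> bool) \<Rightarrow> 'b set \<Rightarrow> nat \<Rightarrow> 'a set \<Rightarrow> ((nat \<Rightarrow> 'a) \<Rightarrow> bool) \<Rightarrow> ('b \<Rightarrow> 'a set)
      \<Rightarrow> 'b set \<Rightarrow> ('b \<Rightarrow> nat \<Rightarrow> 'a) set" where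
  "partial_blowups R I s X G Z A = {\<psi> \<in> I \<rightarrow>\<^sub>E ({..<s} \<rightarrow>\<^sub>E X). transversals_in R I s A \<psi>
      \<and> (\<forall>x\<in>A. G (\<psi> x)) \<and> (\<forall>x\<in>I - A. \<psi> x 0 \<in> Z x)}"

text \<open>All choices of the set \<open>A\<close> of columns already blown up and of the next column \<open>i\<close> are
  gathered in one index set, so that one colouring is regular for all of them.\<close>

definition fibre_index :: "'b set \<Rightarrow> nat \<Rightarrow> 'a set \<Rightarrow> (('b set \<times> 'b) \<times> ('b \<Rightarrow> nat \<Rightarrow> 'a)) set" where
  "fibre_index I s X = Sigma (Pow I \<times> I) (\<lambda>(A, i). (I - {i}) \<rightarrow>\<^sub>E ({..<s} \<rightarrow>\<^sub>E X))"

text \<open>The indicator, as a function of the vertex \<open>y\<close> in column \<open>i\<close>,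
  that the remaining columns \<open>u\<close> extend. Its column is constant because the fibres have
  to be functions on \<open>X\<close>, not on tuples.\<close>

definition fibre :: "(('b \<Rightarrow> 'a) \<Rightarrow> bool) \<Rightarrow> 'b set \<Rightarrow> nat \<Rightarrow>
    (('b set \<times> 'b) \<times> ('b \<Rightarrow> nat \<Rightarrow> 'a)) \<Rightarrow> 'a \<Rightarrow> real" where
  "fibre R I s = (\<lambda>((A, i), u) y. of_bool (transversals_in R I s A (u(i := \<lambda>_\<in>{..<s}. y))))"

lemma finite_fibre_index:
  assumes "finite I" "finite X"
  shows "finite (fibre_index I s X)"
  unfolding fibre_index_def using assms by (auto intro!: finite_SigmaI finite_PiE)

lemma card_fibre_index:
  assumes "finite I" "finite X"
  shows "card (fibre_index I s X) = 2 ^ card I * card I * (card X ^ s) ^ (card I - 1)"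
proof -
  have "card (fibre_index I s X) = (\<Sum>(A, i)\<in>Pow I \<times> I. card ((I - {i}) \<rightarrow>\<^sub>E ({..<s} \<rightarrow>\<^sub>E X)))"
    unfolding fibre_index_def using assms
    by (subst card_SigmaI) (auto intro!: finite_PiE sum.cong)
  also have "\<dots> = (\<Sum>(A, i)\<in>Pow I \<times> I. (card X ^ s) ^ (card I - 1))"
    using assms by (intro sum.cong) (auto simp: card_funcsetE)
  finally show ?thesis using assms by (simp add: card_Pow)
qed

lemma sum_fibre_index_slice:
  fixes F :: "('b \<Rightarrow> nat \<Rightarrow> 'a) \<Rightarrow> real"
  assumes "finite I" "finite X" "A \<subseteq> I" "i \<in> I"
  shows "(\<Sum>p\<in>fibre_index I s X. if fst p = (A, i) then F (snd p) else 0)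
     = (\<Sum>u\<in>(I - {i}) \<rightarrow>\<^sub>E ({..<s} \<rightarrow>\<^sub>E X). F u)"
proof -
  have "(\<Sum>p\<in>fibre_index I s X. if fst p = (A, i) then F (snd p) else 0)
      = (\<Sum>p\<in>{p \<in> fibre_index I s X. fst p = (A, i)}. F (snd p))"
    using finite_fibre_index[OF assms(1,2)] by (rule sum.inter_filter[symmetric])
  also have "{p \<in> fibre_index I s X. fst p = (A, i)}
      = Pair (A, i) ` ((I - {i}) \<rightarrow>\<^sub>E ({..<s} \<rightarrow>\<^sub>E X))"
    using assms by (auto simp: fibre_index_def)
  also have "(\<Sum>p\<in>\<dots>. F (snd p)) = (\<Sum>u\<in>(I - {i}) \<rightarrow>\<^sub>E ({..<s} \<rightarrow>\<^sub>E X). F u)"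
    by (subst sum.reindex) (auto simp: inj_on_def)
  finally show ?thesis .
qed

text \<open>An application of \<open>column_step\<close> to the fibres, with a weight that is
  supported on the pair \<open>(A, i)\<close> and encodes all conditions on the other columns. One
  pair accounts for a \<open>1 / M\<close> part of the index set, hence the density
  \<open>\<gamma> / M\<close>.\<close>

lemma blow_up_column:
  fixes I :: "'b set" and X :: "'a set" and s :: nat and G :: "(nat \<Rightarrow> 'a) \<Rightarrow> bool"
  defines "M \<equiv> 2 ^ card I * real (card I)" and "U \<equiv> fibre_index I s X"
    and "Q \<equiv> {..<s} \<rightarrow>\<^sub>E X"
  assumes fin: "finite I" "finite X" and ne: "X \<noteq> {}" and s: "s \<ge> 1"
    and A: "A \<subseteq> I" "i \<in> I" "i \<notin> A"
    and pos: "\<gamma> > 0" "\<rho> \<ge> 0" "\<epsilon> \<ge> 0" "\<eta> \<ge> 0"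
    and reg: "real (card {x \<in> X. irregular c X U (fibre R I s) \<eta> (c x)}) \<le> \<eta> * real (card X)"
    and eta: "\<eta> \<le> (\<gamma> / M) / 4" "real s * \<eta> \<le> \<epsilon> * ((\<gamma> / M) / 4) ^ s / 2"
    and Zi: "Z i = {x \<in> X. \<rho> * real (card X) \<le> real (card (colour_class c X (c x))) \<and>
        \<epsilon> * real (card (colour_class c X (c x))) ^ s
          \<le> real (card {q \<in> {..<s} \<rightarrow>\<^sub>E colour_class c X (c x). G q})}"
    and lower: "real (card (partial_blowups R I s X G Z A)) \<ge> \<gamma> * real (card Q) ^ card I"
  shows "real (card (partial_blowups R I s X G Z (insert i A)))
      \<ge> \<rho> ^ s * (\<epsilon> * ((\<gamma> / M) / 4) ^ s / 2) * real (card Q) ^ card I"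
proof -
  define J where "J = I - {i}"
  have IJ: "I = insert i J" "i \<notin> J" using A by (auto simp: J_def)
  have vJ: "card I = Suc (card J)" using fin IJ by simp
  then have vJ': "card J = card I - 1" by simp
  have M0: "M \<ge> 1"
  proof -
    have "1 * 1 \<le> (2::real) ^ card I * real (card I)"
      using vJ by (intro mult_mono one_le_power) auto
    then show ?thesis by (simp add: M_def)
  qed
  let ?n = "real (card X)"
  have n0: "?n > 0" using fin ne by (auto simp: card_gt_0_iff)
  have cQ: "card Q = card X ^ s" by (simp add: Q_def card_funcsetE)
  have finU: "finite U" using fin by (simp add: U_def finite_fibre_index)
  have cU: "real (card U) = M * real (card Q) ^ card J"
    using fin vJ' by (simp add: U_def card_fibre_index M_def cQ)
  have neU: "U \<noteq> {}"
  proof -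
    have "real (card U) > 0" using cU M0 n0 cQ by simp
    then show ?thesis by auto
  qed
  define P where "P j \<longleftrightarrow> \<rho> * real (card X) \<le> real (card (colour_class c X j)) \<and>
        \<epsilon> * real (card (colour_class c X j)) ^ s
          \<le> real (card {q \<in> {..<s} \<rightarrow>\<^sub>E colour_class c X j. G q})" for j
  have ZP: "Z i = {x \<in> X. P (c x)}" unfolding Zi P_def ..
  define wA where "wA u = (of_bool ((\<forall>x\<in>A. G (u x)) \<and> (\<forall>x\<in>J - A. u x 0 \<in> Z x)) :: real)" for u
  define w where "w p = (if fst p = (A, i) then wA (snd p) else 0)" for p
  define t where "t u y = (of_bool (transversals_in R I s A (u(i := \<lambda>_\<in>{..<s}. y))) :: real)" for u y
  have card_sum: "real (card (partial_blowups R I s X G Z B))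
     = (\<Sum>u\<in>J \<rightarrow>\<^sub>E Q. \<Sum>q\<in>Q. of_bool (transversals_in R I s B (u(i := q))
      \<and> (\<forall>x\<in>B. G ((u(i := q)) x)) \<and> (\<forall>x\<in>I - B. (u(i := q)) x 0 \<in> Z x)))" for B
  proof -
    have "finite (I \<rightarrow>\<^sub>E Q)" using fin by (auto intro!: finite_PiE simp: Q_def)
    then have "real (card (partial_blowups R I s X G Z B))
      = (\<Sum>\<psi>\<in>I \<rightarrow>\<^sub>E Q. of_bool (transversals_in R I s B \<psi>
      \<and> (\<forall>x\<in>B. G (\<psi> x)) \<and> (\<forall>x\<in>I - B. \<psi> x 0 \<in> Z x)))"
      unfolding partial_blowups_def Q_def[symmetric] by (simp add: sum.inter_filter[symmetric] of_bool_def)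
    also have "\<dots> = (\<Sum>u\<in>J \<rightarrow>\<^sub>E Q. \<Sum>q\<in>Q. of_bool (transversals_in R I s B (u(i := q))
      \<and> (\<forall>x\<in>B. G ((u(i := q)) x)) \<and> (\<forall>x\<in>I - B. (u(i := q)) x 0 \<in> Z x)))"
      by (subst IJ(1), subst sum_PiE_insert[OF IJ(2)]) (simp only: IJ(1)[symmetric])
    finally show ?thesis .
  qed
  \<comment> \<open>Restriction to one slice is done by the weight alone, so regularity on the whole
    index set can be used as it stands.\<close>
  have slice: "(\<Sum>p\<in>U. w p * F p) = (\<Sum>u\<in>J \<rightarrow>\<^sub>E Q. wA u * F ((A, i), u))" for F
  proof -
    have "(\<Sum>p\<in>U. w p * F p) = (\<Sum>p\<in>U. if fst p = (A, i) then wA (snd p) * F ((A, i), snd p) else 0)"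
      by (intro sum.cong) (auto simp: w_def)
    also have "\<dots> = (\<Sum>u\<in>J \<rightarrow>\<^sub>E Q. wA u * F ((A, i), u))"
      unfolding U_def Q_def J_def using fin A by (intro sum_fibre_index_slice) auto
    finally show ?thesis .
  qed
  \<comment> \<open>Before the replacement only entry 0 of column \<open>i\<close> is constrained;
    its other \<open>s - 1\<close> entries are free and give the power of \<open>?n\<close>.\<close>
  have old: "real (card (partial_blowups R I s X G Z A))
      = ?n ^ (s - 1) * (\<Sum>y | y \<in> X \<and> P (c y). \<Sum>p\<in>U. w p * fibre R I s p y)"
  proof -
    have "real (card (partial_blowups R I s X G Z A))
      = (\<Sum>u\<in>J \<rightarrow>\<^sub>E Q. \<Sum>q\<in>Q. wA u * (of_bool (q 0 \<in> Z i) * t u (q 0)))"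
      unfolding card_sum
    proof (intro sum.cong refl)
      fix u q
      have "(\<forall>x\<in>A. G ((u(i := q)) x)) \<longleftrightarrow> (\<forall>x\<in>A. G (u x))"
        using A by auto
      moreover have "(\<forall>x\<in>I - A. (u(i := q)) x 0 \<in> Z x) \<longleftrightarrow> q 0 \<in> Z i \<and> (\<forall>x\<in>J - A. u x 0 \<in> Z x)"
        using A by (auto simp: J_def)
      ultimately show "of_bool (transversals_in R I s A (u(i := q))
          \<and> (\<forall>x\<in>A. G ((u(i := q)) x)) \<and> (\<forall>x\<in>I - A. (u(i := q)) x 0 \<in> Z x))
        = wA u * (of_bool (q 0 \<in> Z i) * t u (q 0))"
        unfolding transversals_in_upd_zero[OF A(2,3) s, of R u q] wA_def t_def
        by (simp only: of_bool_conj mult_ac)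
    qed
    also have "\<dots> = (\<Sum>u\<in>J \<rightarrow>\<^sub>E Q. real (card X ^ (s - 1)) * (\<Sum>y\<in>X. wA u * (of_bool (y \<in> Z i) * t u y)))"
      unfolding Q_def using sum_PiE_zero[OF s, of "\<lambda>y. wA _ * (of_bool (y \<in> Z i) * t _ y)" X] by simp
    also have "\<dots> = ?n ^ (s - 1) * (\<Sum>y\<in>X. \<Sum>u\<in>J \<rightarrow>\<^sub>E Q. wA u * (of_bool (y \<in> Z i) * t u y))"
      by (subst sum.swap) (simp only: sum_distrib_left of_nat_power)
    also have "(\<Sum>y\<in>X. \<Sum>u\<in>J \<rightarrow>\<^sub>E Q. wA u * (of_bool (y \<in> Z i) * t u y))
        = (\<Sum>y\<in>X. if P (c y) then (\<Sum>u\<in>J \<rightarrow>\<^sub>E Q. wA u * t u y) else 0)"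
      by (intro sum.cong) (auto simp: ZP)
    also have "\<dots> = (\<Sum>y | y \<in> X \<and> P (c y). \<Sum>p\<in>U. w p * fibre R I s p y)"
      using fin by (simp add: sum.inter_filter[symmetric] slice fibre_def t_def)
    finally show ?thesis .
  qed
  \<comment> \<open>After the replacement every entry of column \<open>i\<close> is tested, which
    turns the indicator into a product over the entries, and the column itself has to lie in
    \<open>G\<close>.\<close>
  have new: "real (card (partial_blowups R I s X G Z (insert i A)))
      = (\<Sum>q | q \<in> Q \<and> G q. \<Sum>p\<in>U. w p * (\<Prod>b<s. fibre R I s p (q b)))"
  proof -
    have "real (card (partial_blowups R I s X G Z (insert i A)))
      = (\<Sum>u\<in>J \<rightarrow>\<^sub>E Q. \<Sum>q\<in>Q. (if G q then wA u * (\<Prod>b<s. t u (q b)) else 0))"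
      unfolding card_sum
    proof (intro sum.cong refl)
      fix u q
      have pr: "(\<Prod>b<s. t u (q b)) = of_bool (\<forall>b<s. transversals_in R I s A (u(i := \<lambda>_\<in>{..<s}. q b)))"
        unfolding t_def by (induction s) (auto simp: less_Suc_eq simp del: fun_upd_apply)
      have "(\<forall>x\<in>insert i A. G ((u(i := q)) x)) \<longleftrightarrow> G q \<and> (\<forall>x\<in>A. G (u x))"
        using A by auto
      moreover have "(\<forall>x\<in>I - insert i A. (u(i := q)) x 0 \<in> Z x) \<longleftrightarrow> (\<forall>x\<in>J - A. u x 0 \<in> Z x)"
        using A by (auto simp: J_def)
      ultimately show "of_bool (transversals_in R I s (insert i A) (u(i := q))
          \<and> (\<forall>x\<in>insert i A. G ((u(i := q)) x)) \<and> (\<forall>x\<in>I - insert i A. (u(i := q)) x 0 \<in> Z x))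
        = (if G q then wA u * (\<Prod>b<s. t u (q b)) else 0)"
        unfolding transversals_in_insert[OF A(2,3)] wA_def pr
        by (cases "G q") (simp_all only: of_bool_conj mult_ac if_True if_False of_bool_eq mult_zero_left mult_1_left)
    qed
    also have "\<dots> = (\<Sum>q\<in>Q. if G q then (\<Sum>u\<in>J \<rightarrow>\<^sub>E Q. wA u * (\<Prod>b<s. t u (q b))) else 0)"
      by (subst sum.swap) (intro sum.cong, auto)
    also have "\<dots> = (\<Sum>q | q \<in> Q \<and> G q. \<Sum>p\<in>U. w p * (\<Prod>b<s. fibre R I s p (q b)))"
      using fin by (simp add: sum.inter_filter[symmetric] slice fibre_def t_def Q_def finite_PiE)
    finally show ?thesis .
  qed
  have step: "(\<Sum>q | q \<in> {..<s} \<rightarrow>\<^sub>E X \<and> G q. \<Sum>p\<in>U. w p * (\<Prod>b<s. fibre R I s p (q b)))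
      \<ge> \<rho> ^ s * (\<epsilon> * ((\<gamma> / M) / 4) ^ s / 2) * ?n ^ s * real (card U)"
  proof (rule column_step[where c = c and P = P and \<eta> = \<eta>])
    show "0 \<le> fibre R I s u x \<and> fibre R I s u x \<le> 1" for u x
      by (auto simp: fibre_def split: prod.splits)
    show "0 \<le> w u \<and> w u \<le> 1" for u by (auto simp: w_def wA_def)
    show "\<gamma> / M * ?n * real (card U) \<le> (\<Sum>y | y \<in> X \<and> P (c y). \<Sum>p\<in>U. w p * fibre R I s p y)"
    proof -
      have "?n ^ (s - 1) * (\<gamma> / M * ?n * real (card U)) = \<gamma> * (?n ^ (s - 1) * ?n) * real (card Q) ^ card J"
        using M0 by (simp add: cU)
      also have "?n ^ (s - 1) * ?n = real (card Q)"
        using s by (cases s) (simp_all add: cQ)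
      also have "\<gamma> * real (card Q) * real (card Q) ^ card J \<le> real (card (partial_blowups R I s X G Z A))"
        using lower by (simp add: vJ mult_ac)
      finally show ?thesis
        unfolding old by (rule mult_left_le_imp_le) (use n0 in simp)
    qed
  qed (use fin ne neU finU s pos eta reg M0 in \<open>auto simp: P_def\<close>)
  define \<kappa> where "\<kappa> = \<rho> ^ s * (\<epsilon> * ((\<gamma> / M) / 4) ^ s / 2)"
  have "\<kappa> * real (card Q) ^ card I * 1 \<le> \<kappa> * real (card Q) ^ card I * M"
    using M0 pos unfolding \<kappa>_def by (intro mult_left_mono mult_nonneg_nonneg) auto
  also have "\<dots> = \<kappa> * ?n ^ s * real (card U)"
    by (simp add: cU cQ vJ mult_ac)
  also have "\<dots> \<le> real (card (partial_blowups R I s X G Z (insert i A)))"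
    using step unfolding new Q_def \<kappa>_def .
  finally show ?thesis by (simp add: \<kappa>_def)
qed

section \<open>Levels\<close>

text \<open>The two conditions are what \<open>column_step\<close> asks of a class. They concern
  only the class of \<open>x\<close>, so the set is a union of colour classes.\<close>

definition rich_vertices :: "('a \<Rightarrow> nat) \<Rightarrow> 'a set \<Rightarrow> nat \<Rightarrow> ((nat \<Rightarrow> 'a) \<Rightarrow> bool) \<Rightarrow> real \<Rightarrow> real \<Rightarrow> 'a set" where
  "rich_vertices c X s G \<rho> \<epsilon> = {x \<in> X. \<rho> * real (card X) \<le> real (card (colour_class c X (c x))) \<and>
        \<epsilon> * real (card (colour_class c X (c x))) ^ s
          \<le> real (card {q \<in> {..<s} \<rightarrow>\<^sub>E colour_class c X (c x). G q})}"

text \<open>With \<open>A\<close> empty all conditions concern the entries 0, which form an ordinary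
  map into \<open>X\<close>; the remaining \<open>s - 1\<close> entries of every column are
  free.\<close>

lemma card_partial_blowups_empty:
  assumes fin: "finite I" "finite X" and s: "s \<ge> 1"
  shows "real (card (partial_blowups R I s X G Z {}))
     = real (card X ^ (s - 1)) ^ card I * real (card {\<phi> \<in> I \<rightarrow>\<^sub>E X. R \<phi> \<and> (\<forall>x\<in>I. \<phi> x \<in> Z x)})"
proof -
  let ?Q = "{..<s} \<rightarrow>\<^sub>E X"
  let ?F = "\<lambda>\<phi>. of_bool (R \<phi> \<and> (\<forall>x\<in>I. \<phi> x \<in> Z x)) :: real"
  have "transversals_in R I s {} \<psi> \<longleftrightarrow> R (\<lambda>x\<in>I. \<psi> x 0)" for \<psi>
  proof -
    have eq: "(\<lambda>x\<in>I. \<psi> x (g x)) = (\<lambda>x\<in>I. \<psi> x 0)" if "\<forall>x\<in>I - {}. g x = 0" for g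
      using that by (auto simp: restrict_def fun_eq_iff)
    show ?thesis
    proof
      assume *: "transversals_in R I s {} \<psi>"
      have "(\<lambda>x\<in>I. 0) \<in> I \<rightarrow>\<^sub>E {..<s}" using s by auto
      with * have "R (\<lambda>x\<in>I. \<psi> x ((\<lambda>x\<in>I. 0) x))" unfolding transversals_in_def by fastforce
      then show "R (\<lambda>x\<in>I. \<psi> x 0)" using eq[of "\<lambda>x\<in>I. 0"] by simp
    next
      assume "R (\<lambda>x\<in>I. \<psi> x 0)"
      then show "transversals_in R I s {} \<psi>"
        unfolding transversals_in_def using eq by (metis (no_types, lifting))
    qed
  qed
  then have "partial_blowups R I s X G Z {}
      = {\<psi> \<in> I \<rightarrow>\<^sub>E ?Q. R (\<lambda>x\<in>I. \<psi> x 0) \<and> (\<forall>x\<in>I. (\<lambda>x\<in>I. \<psi> x 0) x \<in> Z x)}"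
    unfolding partial_blowups_def by auto
  moreover have "finite (I \<rightarrow>\<^sub>E ?Q)" using fin by (auto intro!: finite_PiE)
  ultimately have "real (card (partial_blowups R I s X G Z {})) = (\<Sum>\<psi>\<in>I \<rightarrow>\<^sub>E ?Q. ?F (\<lambda>x\<in>I. \<psi> x 0))"
    by (simp add: sum.inter_filter[symmetric] of_bool_def del: restrict_apply)
  also have "\<dots> = real (card X ^ (s - 1)) ^ card I * (\<Sum>\<phi>\<in>I \<rightarrow>\<^sub>E X. ?F \<phi>)"
    by (rule sum_PiE_project[OF fin(1), of "\<lambda>q. q 0"]) (rule sum_PiE_zero[OF s])
  also have "(\<Sum>\<phi>\<in>I \<rightarrow>\<^sub>E X. ?F \<phi>) = real (card {\<phi> \<in> I \<rightarrow>\<^sub>E X. R \<phi> \<and> (\<forall>x\<in>I. \<phi> x \<in> Z x)})"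
    using fin by (simp add: sum.inter_filter[symmetric] of_bool_def finite_PiE)
  finally show ?thesis .
qed

text \<open>The columns are blown up in increasing order of their levels: the regularity parameter
  of a level only has to be small compared with the density that survives the lower levels.\<close>

lemma blow_up_all_columns:
  fixes I :: "'b set" and X :: "'a set" and s :: nat and G :: "(nat \<Rightarrow> 'a) \<Rightarrow> bool"
    and lev :: "'b \<Rightarrow> nat" and \<gamma> \<eta> \<rho> :: "nat \<Rightarrow> real"
  defines "M \<equiv> 2 ^ card I * real (card I)"
  assumes fin: "finite I" "finite X" and ne: "X \<noteq> {}" and s: "s \<ge> 1"
    and lev: "inj_on lev I" "lev ` I \<subseteq> {..<L}" and eps: "\<epsilon> \<ge> 0"
    and pos: "\<And>l. \<gamma> l > 0" "\<And>l. \<rho> l \<ge> 0" "\<And>l. \<eta> l \<ge> 0"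
    and step: "\<And>l. \<gamma> (Suc l) \<le> \<gamma> l"
      "\<And>l. \<gamma> (Suc l) \<le> \<rho> l ^ s * (\<epsilon> * ((\<gamma> l / M) / 4) ^ s / 2)"
    and eta: "\<And>l. \<eta> l \<le> (\<gamma> l / M) / 4" "\<And>l. real s * \<eta> l \<le> \<epsilon> * ((\<gamma> l / M) / 4) ^ s / 2"
    and reg: "\<And>l. l < L \<Longrightarrow> real (card {x \<in> X. irregular (c l) X (fibre_index I s X) (fibre R I s) (\<eta> l) (c l x)})
        \<le> \<eta> l * real (card X)"
    and lower: "real (card {\<phi> \<in> I \<rightarrow>\<^sub>E X. R \<phi> \<and>
        (\<forall>x\<in>I. \<phi> x \<in> rich_vertices (c (lev x)) X s G (\<rho> (lev x)) \<epsilon>)}) \<ge> \<gamma> 0 * real (card X) ^ card I"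
  shows "real (card {\<psi> \<in> I \<rightarrow>\<^sub>E ({..<s} \<rightarrow>\<^sub>E X). transversals_in R I s I \<psi> \<and> (\<forall>x\<in>I. G (\<psi> x))})
      \<ge> \<gamma> L * real (card X ^ s) ^ card I"
proof -
  define Z where "Z x = rich_vertices (c (lev x)) X s G (\<rho> (lev x)) \<epsilon>" for x
  define Q where "Q = {..<s} \<rightarrow>\<^sub>E X"
  have cQ: "card Q = card X ^ s" by (simp add: Q_def card_funcsetE)
  \<comment> \<open>Induction on the level. By injectivity at most one column has level
    \<open>m\<close>; if there is none, the set of replaced columns stays the same and the bound
    only weakens.\<close>
  have "real (card (partial_blowups R I s X G Z {x \<in> I. lev x < m})) \<ge> \<gamma> m * real (card Q) ^ card I"
    if "m \<le> L" for m
    using that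
  proof (induction m)
    case 0
    have "\<gamma> 0 * real (card Q) ^ card I
        = real (card X ^ (s - 1)) ^ card I * (\<gamma> 0 * real (card X) ^ card I)"
    proof -
      have "real (card Q) = real (card X ^ (s - 1)) * real (card X)"
        using s by (cases s) (simp_all add: cQ)
      then show ?thesis by (simp add: power_mult_distrib)
    qed
    also have "\<dots> \<le> real (card (partial_blowups R I s X G Z {}))"
      unfolding card_partial_blowups_empty[OF fin s]
      using lower by (intro mult_left_mono) (auto simp: Z_def)
    finally show ?case by simp
  next
    case (Suc m)
    then have IH: "real (card (partial_blowups R I s X G Z {x \<in> I. lev x < m})) \<ge> \<gamma> m * real (card Q) ^ card I"
      and m: "m < L" by auto
    show ?case
    proof (cases "\<exists>i\<in>I. lev i = m")
      case False
      then have "{x \<in> I. lev x < Suc m} = {x \<in> I. lev x < m}" by (auto simp: less_Suc_eq)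
      moreover have "\<gamma> (Suc m) * real (card Q) ^ card I \<le> \<gamma> m * real (card Q) ^ card I"
        using step(1) by (intro mult_right_mono) auto
      ultimately show ?thesis using IH by simp
    next
      case True
      then obtain i where i: "i \<in> I" "lev i = m" by blast
      have ins: "{x \<in> I. lev x < Suc m} = insert i {x \<in> I. lev x < m}"
        using i lev(1) by (auto simp: less_Suc_eq inj_on_def)
      have "\<rho> m ^ s * (\<epsilon> * ((\<gamma> m / M) / 4) ^ s / 2) * real (card Q) ^ card I
          \<le> real (card (partial_blowups R I s X G Z (insert i {x \<in> I. lev x < m})))"
        unfolding M_def Q_def
      proof (rule blow_up_column[where c = "c m" and \<eta> = "\<eta> m"])
        show "\<eta> m \<le> \<gamma> m / (2 ^ card I * real (card I)) / 4"
          "real s * \<eta> m \<le> \<epsilon> * (\<gamma> m / (2 ^ card I * real (card I)) / 4) ^ s / 2"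
          using eta[of m] unfolding M_def by auto
        show "Z i = {x \<in> X. \<rho> m * real (card X) \<le> real (card (colour_class (c m) X (c m x))) \<and>
        \<epsilon> * real (card (colour_class (c m) X (c m x))) ^ s
          \<le> real (card {q \<in> {..<s} \<rightarrow>\<^sub>E colour_class (c m) X (c m x). G q})}"
          unfolding Z_def i rich_vertices_def ..
        show "\<gamma> m * real (card ({..<s} \<rightarrow>\<^sub>E X)) ^ card I
          \<le> real (card (partial_blowups R I s X G Z {x \<in> I. lev x < m}))"
          using IH unfolding Q_def .
      qed (use fin ne s i pos eps reg[OF m] in auto)
      moreover have "\<gamma> (Suc m) * real (card Q) ^ card I
          \<le> \<rho> m ^ s * (\<epsilon> * ((\<gamma> m / M) / 4) ^ s / 2) * real (card Q) ^ card I"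
        using step(2) by (intro mult_right_mono) auto
      ultimately show ?thesis unfolding ins by linarith
    qed
  qed
  from this[of L] have *: "real (card (partial_blowups R I s X G Z {x \<in> I. lev x < L})) \<ge> \<gamma> L * real (card Q) ^ card I"
    by simp
  moreover have "{x \<in> I. lev x < L} = I" using lev by auto
  ultimately show ?thesis unfolding cQ by (simp add: partial_blowups_def)
qed

section \<open>Assigning distinct levels to the vertices of a copy\<close>

text \<open>A greedy choice: fewer than \<open>card I\<close> values are taken at any time, and
  every list has at least \<open>card I\<close>.\<close>

lemma distinct_representatives:
  fixes S :: "'b \<Rightarrow> 'c set"
  assumes "finite I" "\<And>i. i \<in> I \<Longrightarrow> card I \<le> card (S i)"
  shows "\<exists>l. inj_on l I \<and> (\<forall>i\<in>I. l i \<in> S i)"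
  using assms
proof (induction I rule: finite_induct)
  case empty
  then show ?case by simp
next
  case (insert i I)
  then have "\<exists>l. inj_on l I \<and> (\<forall>i\<in>I. l i \<in> S i)" by fastforce
  then obtain l where l: "inj_on l I" "\<forall>i\<in>I. l i \<in> S i" by blast
  have "card (l ` I) < card (S i)"
    using insert.prems[of i] insert.hyps card_image_le[OF insert.hyps(1), of l] by simp
  then have "\<not> S i \<subseteq> l ` I"
    using card_mono[of "l ` I" "S i"] insert.hyps by auto
  then obtain y where y: "y \<in> S i" "y \<notin> l ` I" by blast
  have "inj_on (l(i := y)) (insert i I)"
    using l(1) y(2) insert.hyps by (auto simp: inj_on_def image_iff)
  moreover have "\<forall>j\<in>insert i I. (l(i := y)) j \<in> S j"
    using l(2) y(1) insert.hyps by auto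
  ultimately show ?case by blast
qed

text \<open>Each vertex of \<open>Z\<close> is rich at \<open>card I\<close> levels or more, so
  every map into \<open>Z\<close> admits an injective level assignment along which it is rich. There
  are at most \<open>L ^ card I\<close> assignments, and by pigeonhole one of them carries enough
  maps for \<open>blow_up_all_columns\<close>.\<close>

lemma blow_up_rich:
  fixes I :: "'b set" and X :: "'a set" and s :: nat and G :: "(nat \<Rightarrow> 'a) \<Rightarrow> bool"
    and \<gamma> \<eta> \<rho> :: "nat \<Rightarrow> real"
  defines "M \<equiv> 2 ^ card I * real (card I)"
  assumes fin: "finite I" "finite X" and ne: "X \<noteq> {}" and s: "s \<ge> 1" and L: "L > 0" and eps: "\<epsilon> \<ge> 0"
    and pos: "\<And>l. \<gamma> l > 0" "\<And>l. \<rho> l \<ge> 0" "\<And>l. \<eta> l \<ge> 0"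
    and step: "\<And>l. \<gamma> (Suc l) \<le> \<gamma> l"
      "\<And>l. \<gamma> (Suc l) \<le> \<rho> l ^ s * (\<epsilon> * ((\<gamma> l / M) / 4) ^ s / 2)"
    and eta: "\<And>l. \<eta> l \<le> (\<gamma> l / M) / 4" "\<And>l. real s * \<eta> l \<le> \<epsilon> * ((\<gamma> l / M) / 4) ^ s / 2"
    and reg: "\<And>l. l < L \<Longrightarrow> real (card {x \<in> X. irregular (c l) X (fibre_index I s X) (fibre R I s) (\<eta> l) (c l x)})
        \<le> \<eta> l * real (card X)"
    and Z: "Z = {x \<in> X. card I \<le> card {l. l < L \<and> x \<in> rich_vertices (c l) X s G (\<rho> l) \<epsilon>}}"
    and lower: "real (card {\<phi> \<in> I \<rightarrow>\<^sub>E Z. R \<phi>}) \<ge> \<gamma> 0 * real L ^ card I * real (card X) ^ card I"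
  shows "real (card {\<psi> \<in> I \<rightarrow>\<^sub>E ({..<s} \<rightarrow>\<^sub>E X). transversals_in R I s I \<psi> \<and> (\<forall>x\<in>I. G (\<psi> x))})
      \<ge> \<gamma> L * real (card X ^ s) ^ card I"
proof -
  define \<Lambda> where "\<Lambda> = {lev \<in> I \<rightarrow>\<^sub>E {..<L}. inj_on lev I}"
  define T where "T lev = {\<phi> \<in> I \<rightarrow>\<^sub>E X. R \<phi> \<and>
        (\<forall>x\<in>I. \<phi> x \<in> rich_vertices (c (lev x)) X s G (\<rho> (lev x)) \<epsilon>)}" for lev :: "'b \<Rightarrow> nat"
  let ?n = "real (card X)"
  have n0: "?n > 0" using fin ne by (auto simp: card_gt_0_iff)
  have finL: "finite \<Lambda>" using fin by (auto simp: \<Lambda>_def intro!: finite_PiE)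
  have finT: "finite (T lev)" for lev
    unfolding T_def using fin by (simp add: finite_PiE)
  have cover: "{\<phi> \<in> I \<rightarrow>\<^sub>E Z. R \<phi>} \<subseteq> (\<Union>lev\<in>\<Lambda>. T lev)"
  proof
    fix \<phi> assume "\<phi> \<in> {\<phi> \<in> I \<rightarrow>\<^sub>E Z. R \<phi>}"
    then have \<phi>: "\<phi> \<in> I \<rightarrow>\<^sub>E Z" "R \<phi>" by auto
    let ?S = "\<lambda>i. {l. l < L \<and> \<phi> i \<in> rich_vertices (c l) X s G (\<rho> l) \<epsilon>}"
    have "card I \<le> card (?S i)" if "i \<in> I" for i using PiE_mem[OF \<phi>(1) that] unfolding Z by simp
    then have "\<exists>l. inj_on l I \<and> (\<forall>i\<in>I. l i \<in> ?S i)"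
      by (rule distinct_representatives[OF fin(1)])
    then obtain l where l: "inj_on l I" "\<forall>i\<in>I. l i \<in> ?S i" by blast
    \<comment> \<open>Restricting makes the assignment extensional, so that \<Lambda> is finite and
      of size at most \<open>L ^ card I\<close>.\<close>
    have "restrict l I \<in> \<Lambda>" using l by (auto simp: \<Lambda>_def inj_on_def)
    moreover have "\<phi> \<in> T (restrict l I)"
      using \<phi> l(2) unfolding T_def Z by (auto simp: PiE_iff)
    ultimately show "\<phi> \<in> (\<Union>lev\<in>\<Lambda>. T lev)" by blast
  qed
  have "\<exists>lev\<in>\<Lambda>. real (card (T lev)) \<ge> \<gamma> 0 * ?n ^ card I"
  proof (rule ccontr)
    assume neg: "\<not> ?thesis"
    have p: "\<gamma> 0 * real L ^ card I * ?n ^ card I > 0" using pos L n0 by simp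
    have le: "card {\<phi> \<in> I \<rightarrow>\<^sub>E Z. R \<phi>} \<le> (\<Sum>lev\<in>\<Lambda>. card (T lev))"
      using card_mono[OF _ cover] finL finT card_UN_le[OF finL, of T] by (meson finite_UN_I le_trans)
    \<comment> \<open>Strictness of the following sum comparison rests on this: without any
      assignment there would be no map into \<open>Z\<close> satisfying \<open>R\<close>, against
      the positive lower bound.\<close>
    have "\<Lambda> \<noteq> {}"
    proof
      assume "\<Lambda> = {}"
      then show False using le lower p by simp
    qed
    then have "(\<Sum>lev\<in>\<Lambda>. real (card (T lev))) < (\<Sum>lev\<in>\<Lambda>. \<gamma> 0 * ?n ^ card I)"
      using neg finL by (intro sum_strict_mono) (auto simp: not_le)
    also have "\<dots> \<le> real L ^ card I * (\<gamma> 0 * ?n ^ card I)"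
    proof -
      have "card \<Lambda> \<le> card (I \<rightarrow>\<^sub>E {..<L})"
        using fin by (intro card_mono) (auto simp: \<Lambda>_def intro!: finite_PiE)
      also have "\<dots> = L ^ card I" using fin by (simp add: card_funcsetE)
      finally have "real (card \<Lambda>) \<le> real L ^ card I" by (metis of_nat_le_iff of_nat_power)
      then show ?thesis using pos[of 0] by (simp add: mult_right_mono)
    qed
    finally have "(\<Sum>lev\<in>\<Lambda>. real (card (T lev))) < \<gamma> 0 * real L ^ card I * ?n ^ card I"
      by (simp add: mult_ac)
    moreover have "real (card {\<phi> \<in> I \<rightarrow>\<^sub>E Z. R \<phi>}) \<le> (\<Sum>lev\<in>\<Lambda>. real (card (T lev)))"
      using le by (metis of_nat_le_iff of_nat_sum)
    ultimately show False using lower by linarith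
  qed
  then obtain lev where lev: "lev \<in> \<Lambda>" "real (card (T lev)) \<ge> \<gamma> 0 * ?n ^ card I" by blast
  show ?thesis
  proof (rule blow_up_all_columns[where lev = lev and c = c and \<gamma> = \<gamma> and \<eta> = \<eta> and \<rho> = \<rho> and \<epsilon> = \<epsilon>])
    show "inj_on lev I" "lev ` I \<subseteq> {..<L}" using lev(1) by (auto simp: \<Lambda>_def)
    show "\<gamma> 0 * ?n ^ card I \<le> real (card {\<phi> \<in> I \<rightarrow>\<^sub>E X. R \<phi> \<and>
        (\<forall>x\<in>I. \<phi> x \<in> rich_vertices (c (lev x)) X s G (\<rho> (lev x)) \<epsilon>)})"
      using lev(2) unfolding T_def .
  qed (use fin ne s eps pos step eta reg in \<open>simp_all add: M_def\<close>)
qed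

section \<open>Degrees and averaging\<close>

lemma card_inj_functions:
  assumes "finite C"
  shows "card {q \<in> {..<m} \<rightarrow>\<^sub>E C. inj_on q {..<m}} = (\<Prod>i=0..<m. card C - i)"
  using card_inj_on_subset_funcset[of "{..<m}" C "{..<m}"] assms by simp

lemma falling_product_choose:
  fixes N m :: nat
  shows "(\<Prod>i=0..<m. N - i) = fact m * (N choose m)"
proof (induction m)
  case (Suc m)
  have "Suc m * (N choose Suc m) = (N - m) * (N choose m)"
    by (simp only: binomial_absorption binomial_absorb_comp)
  then have "fact m * (Suc m * (N choose Suc m)) = fact m * (N choose m) * (N - m)"
    by (simp only: mult_ac)
  with Suc have "(\<Prod>i=0..<Suc m. N - i) = fact m * (Suc m * (N choose Suc m))" by simp
  then show ?case by (simp only: fact_Suc of_nat_id mult_ac)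
qed simp

text \<open>Every factor is at least \<open>n - k\<close>, because \<open>r + i < k\<close>;
  Bernoulli's inequality bounds the resulting power.\<close>

lemma falling_product_ge:
  assumes "r + m \<le> k" "k \<le> n" "n > 0"
  shows "real (\<Prod>i=0..<m. (n - r) - i) \<ge> (1 - real k * real k / real n) * real n ^ m"
proof -
  have "(1 - real k * real k / real n) * real n ^ m \<le> (1 - real m * (real k / real n)) * real n ^ m"
  proof -
    have "real m * (real k / real n) \<le> real k * (real k / real n)"
      using assms by (intro mult_right_mono) auto
    then show ?thesis by (intro mult_right_mono) auto
  qed
  also have "\<dots> \<le> (1 - real k / real n) ^ m * real n ^ m"
    using Bernoulli_inequality[of "- (real k / real n)" m] assms by (intro mult_right_mono) auto
  also have "\<dots> = (\<Prod>i=0..<m. real n - real k)"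
    using assms by (simp add: power_mult_distrib[symmetric] left_diff_distrib)
  also have "\<dots> \<le> (\<Prod>i=0..<m. real ((n - r) - i))"
    using assms by (intro prod_mono) auto
  finally show ?thesis by simp
qed

text \<open>Each member \<open>T\<close> of the neighbourhood is a set of \<open>k - s\<close>
  vertices with \<open>fact (k - s)\<close> injective enumerations, and an enumeration determines
  \<open>T\<close> as its image.\<close>

lemma degree_ge_nbhd:
  assumes H: "kgraph k X EH" and sk: "s \<le> k"
    and q: "q \<in> {..<s} \<rightarrow>\<^sub>E X" "inj_on q {..<s}"
  shows "card {\<tau> \<in> {..<k - s} \<rightarrow>\<^sub>E X. \<tau> ` {..<k - s} \<union> q ` {..<s} \<in> EH}
      \<ge> fact (k - s) * card (nbhd X EH (q ` {..<s}))"
proof -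
  define S where "S = q ` {..<s}"
  define B where "B T = {\<tau> \<in> {..<k - s} \<rightarrow>\<^sub>E T. inj_on \<tau> {..<k - s}}" for T :: "'a set"
  have finX: "finite X" using H by (simp add: kgraph_def)
  have cS: "card S = s" using q by (simp add: S_def card_image)
  have fS: "finite S" by (simp add: S_def)
  have T: "T \<subseteq> X" "finite T" "card T = k - s" "S \<union> T \<in> EH" if "T \<in> nbhd X EH S" for T
  proof -
    from that have T: "T \<subseteq> X - S" "S \<union> T \<in> EH" by (auto simp: nbhd_def)
    then show "T \<subseteq> X" "S \<union> T \<in> EH" by auto
    show fT: "finite T" using T finX by (meson finite_Diff finite_subset)
    have "card (S \<union> T) = k" using T H by (auto simp: kgraph_def)
    moreover have "card (S \<union> T) = card S + card T"
      using T fT fS by (intro card_Un_disjoint) auto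
    ultimately show "card T = k - s" using cS by simp
  qed
  have img: "\<tau> ` {..<k - s} = T" if "T \<in> nbhd X EH S" "\<tau> \<in> B T" for \<tau> T
    using that T[OF that(1)] by (intro card_subset_eq) (auto simp: B_def card_image)
  have cB: "card (B T) = fact (k - s)" if "T \<in> nbhd X EH S" for T
    unfolding B_def using T[OF that] by (simp add: card_inj_functions fact_prod_rev)
  have finB: "finite (B T)" if "T \<in> nbhd X EH S" for T
    using T[OF that] unfolding B_def by (simp add: finite_PiE)
  have finN: "finite (nbhd X EH S)"
    by (rule finite_subset[of _ "Pow X"]) (use finX in \<open>auto simp: nbhd_def\<close>)
  have "fact (k - s) * card (nbhd X EH S) = (\<Sum>T\<in>nbhd X EH S. card (B T))"
    using cB by simp
  also have "\<dots> = card (\<Union>T\<in>nbhd X EH S. B T)"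
  proof (rule card_UN_disjoint[symmetric])
    show "\<forall>T\<in>nbhd X EH S. \<forall>T'\<in>nbhd X EH S. T \<noteq> T' \<longrightarrow> B T \<inter> B T' = {}"
      using img by blast
  qed (use finN finB in auto)
  also have "\<dots> \<le> card {\<tau> \<in> {..<k - s} \<rightarrow>\<^sub>E X. \<tau> ` {..<k - s} \<union> q ` {..<s} \<in> EH}"
  proof (rule card_mono)
    show "finite {\<tau> \<in> {..<k - s} \<rightarrow>\<^sub>E X. \<tau> ` {..<k - s} \<union> q ` {..<s} \<in> EH}"
      using finX by (simp add: finite_PiE)
    show "(\<Union>T\<in>nbhd X EH S. B T) \<subseteq> {\<tau> \<in> {..<k - s} \<rightarrow>\<^sub>E X. \<tau> ` {..<k - s} \<union> q ` {..<s} \<in> EH}"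
    proof
      fix \<tau> assume "\<tau> \<in> (\<Union>T\<in>nbhd X EH S. B T)"
      then obtain T' where T': "T' \<in> nbhd X EH S" "\<tau> \<in> B T'" by blast
      have "\<tau> \<in> {..<k - s} \<rightarrow>\<^sub>E X" using T'(2) T(1)[OF T'(1)] by (auto simp: B_def PiE_iff)
      moreover have "\<tau> ` {..<k - s} \<union> q ` {..<s} \<in> EH"
        using img[OF T'] T(4)[OF T'(1)] unfolding S_def by (simp add: Un_commute)
      ultimately show "\<tau> \<in> {\<tau> \<in> {..<k - s} \<rightarrow>\<^sub>E X. \<tau> ` {..<k - s} \<union> q ` {..<s} \<in> EH}" by simp
    qed
  qed
  finally show ?thesis unfolding S_def .
qed

text \<open>A tuple of low degree either repeats a vertex or enumerates a set in \<open>Low\<close>.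
  Each kind makes up at most a \<theta> share of all tuples: the first because
  \<open>k * k / n\<close> is small, the second by the density hypothesis. The slack \<beta> absorbs
  the difference between falling products and powers.\<close>

lemma few_low_degree_tuples:
  fixes X :: "'a set" and EH :: "'a set set" and k s :: nat and \<delta> \<theta> \<beta> :: real
  defines "Low \<equiv> {S. S \<subseteq> X \<and> card S = s \<and>
      real (card (nbhd X EH S)) < \<delta> * real ((card X - s) choose (k - s))}"
  assumes H: "kgraph k X EH" and sk: "s \<le> k" and n: "k \<le> card X" "card X > 0"
    and kn: "real k * real k / real (card X) \<le> \<theta>" "real k * real k / real (card X) \<le> \<beta>"
    and \<delta>: "0 \<le> \<delta>" "\<delta> \<le> 1"
    and low: "graph_density (card X) s Low < \<theta>"
  shows "real (card {q \<in> {..<s} \<rightarrow>\<^sub>E X.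
      real (card {\<tau> \<in> {..<k - s} \<rightarrow>\<^sub>E X. \<tau> ` {..<k - s} \<union> q ` {..<s} \<in> EH})
        < (\<delta> - \<beta>) * real (card X) ^ (k - s)}) \<le> 2 * \<theta> * real (card X) ^ s" (is "real (card ?Bad) \<le> _")
proof -
  let ?n = "real (card X)" and ?Q = "{..<s} \<rightarrow>\<^sub>E X"
  define NI where "NI = {q \<in> ?Q. \<not> inj_on q {..<s}}"
  define LI where "LI = (\<Union>S\<in>Low. {q \<in> {..<s} \<rightarrow>\<^sub>E S. inj_on q {..<s}})"
  have finX: "finite X" using H by (simp add: kgraph_def)
  have finQ: "finite ?Q" using finX by (simp add: finite_PiE)
  have finLow: "finite Low"
    by (rule finite_subset[of _ "Pow X"]) (use finX in \<open>auto simp: Low_def\<close>)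
  have finS: "finite S" if "S \<in> Low" for S
    using that finX by (auto simp: Low_def intro: finite_subset)
  have finLI: "finite LI" unfolding LI_def using finLow finS by (auto simp: finite_PiE)
  have "?Bad \<subseteq> NI \<union> LI"
  proof
    fix q assume q: "q \<in> ?Bad"
    show "q \<in> NI \<union> LI"
    proof (cases "inj_on q {..<s}")
      case False
      then show ?thesis using q by (auto simp: NI_def)
    next
      case True
      have "q ` {..<s} \<in> Low"
      proof (rule ccontr)
        assume "q ` {..<s} \<notin> Low"
        moreover have "q ` {..<s} \<subseteq> X" "card (q ` {..<s}) = s"
          using q True by (auto simp: card_image)
        ultimately have nb: "real (card (nbhd X EH (q ` {..<s}))) \<ge> \<delta> * real ((card X - s) choose (k - s))"
          by (simp add: Low_def not_less)
        \<comment> \<open>Contrapositive: an injective tuple whose set is not in \<open>Low\<close>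
          already has degree at least \<delta> times a falling product, and this exceeds the
          threshold with \<beta> subtracted.\<close>
        have "(\<delta> - \<beta>) * ?n ^ (k - s) \<le> \<delta> * ((1 - real k * real k / ?n) * ?n ^ (k - s))"
        proof -
          have "\<delta> * (real k * real k / ?n) \<le> 1 * (real k * real k / ?n)"
            using \<delta> by (intro mult_right_mono) auto
          then have "\<delta> - \<beta> \<le> \<delta> * (1 - real k * real k / ?n)"
            using kn by (simp add: right_diff_distrib)
          then have "(\<delta> - \<beta>) * ?n ^ (k - s) \<le> \<delta> * (1 - real k * real k / ?n) * ?n ^ (k - s)"
            by (intro mult_right_mono) auto
          then show ?thesis by (simp only: mult.assoc)
        qed
        also have "\<dots> \<le> \<delta> * real (\<Prod>i=0..<k - s. (card X - s) - i)"
          using falling_product_ge[of s "k - s" k "card X"] sk n \<delta> by (intro mult_left_mono) auto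
        also have "\<dots> = \<delta> * real (fact (k - s) * ((card X - s) choose (k - s)))"
          unfolding falling_product_choose ..
        also have "\<dots> = fact (k - s) * (\<delta> * real ((card X - s) choose (k - s)))"
          by simp
        also have "\<dots> \<le> fact (k - s) * real (card (nbhd X EH (q ` {..<s})))"
          using nb by (intro mult_left_mono) auto
        also have "\<dots> = real (fact (k - s) * card (nbhd X EH (q ` {..<s})))" by simp
        also have "\<dots> \<le> real (card {\<tau> \<in> {..<k - s} \<rightarrow>\<^sub>E X. \<tau> ` {..<k - s} \<union> q ` {..<s} \<in> EH})"
          using degree_ge_nbhd[OF H sk _ True] q by (intro of_nat_mono) auto
        finally show False using q by simp
      qed
      moreover have "q \<in> {..<s} \<rightarrow>\<^sub>E q ` {..<s}" using q by (auto simp: PiE_iff)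
      ultimately show ?thesis using True unfolding LI_def by blast
    qed
  qed
  then have "card ?Bad \<le> card (NI \<union> LI)"
    using finLI finQ by (intro card_mono) (auto simp: NI_def)
  also have "\<dots> \<le> card NI + card LI" by (rule card_Un_le)
  finally have "real (card ?Bad) \<le> real (card NI) + real (card LI)" by linarith
  moreover have "real (card NI) \<le> \<theta> * ?n ^ s"
  proof -
    have "card ?Q = card {q \<in> ?Q. inj_on q {..<s}} + card NI"
      unfolding NI_def using finQ
      by (subst card_Un_disjoint[symmetric]) (auto intro!: arg_cong[of _ _ card])
    then have "real (card X) ^ s = real (card {q \<in> ?Q. inj_on q {..<s}}) + real (card NI)"
      by (metis card_funcsetE card_lessThan finite_lessThan of_nat_add of_nat_power)
    moreover have "real (card {q \<in> ?Q. inj_on q {..<s}}) \<ge> (1 - real k * real k / ?n) * ?n ^ s"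
      unfolding card_inj_functions[OF finX]
      using falling_product_ge[of 0 s k "card X"] sk n by simp
    ultimately have "real (card NI) \<le> (real k * real k / ?n) * ?n ^ s"
      by (simp add: left_diff_distrib)
    also have "\<dots> \<le> \<theta> * ?n ^ s" using kn by (intro mult_right_mono) auto
    finally show ?thesis .
  qed
  moreover have "real (card LI) \<le> \<theta> * ?n ^ s"
  proof -
    have "card LI \<le> (\<Sum>S\<in>Low. card {q \<in> {..<s} \<rightarrow>\<^sub>E S. inj_on q {..<s}})"
      unfolding LI_def by (rule card_UN_le[OF finLow])
    also have "\<dots> = (\<Sum>S\<in>Low. fact s)"
    proof (rule sum.cong[OF refl])
      fix S assume S: "S \<in> Low"
      then have "card S = s" by (simp add: Low_def)
      then show "card {q \<in> {..<s} \<rightarrow>\<^sub>E S. inj_on q {..<s}} = fact s"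
        using card_inj_functions[OF finS[OF S], of s] by (simp add: fact_prod_rev)
    qed
    also have "\<dots> = fact s * card Low" by simp
    finally have "real (card LI) \<le> real (fact s * card Low)"
      by (simp only: of_nat_le_iff)
    also have "\<dots> = fact s * real (card Low)" by simp
    also have "\<dots> \<le> \<theta> * ?n ^ s"
      using low n by (simp add: graph_density_def divide_less_eq)
    finally show ?thesis .
  qed
  ultimately show ?thesis by simp
qed

section \<open>The average number of rich vertices\<close>

text \<open>Double counting of the pairs \<open>(\<tau>, q)\<close> with \<open>G \<tau> q\<close>
  inside one class. One \<beta> is lost in the degree threshold, one to the exceptional tuples, and
  one to those \<tau> whose density on the class is below \<beta>.\<close>

lemma rich_average_class:
  fixes \<delta> \<beta> :: real
  assumes fin: "finite \<Omega>" "finite C" and \<delta>: "\<beta> \<le> \<delta>" "\<delta> \<le> 1" "0 \<le> \<beta>"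
    and ne: "C \<noteq> {}"
    and bad: "real (card {q \<in> {..<s} \<rightarrow>\<^sub>E C. real (card {\<tau> \<in> \<Omega>. G \<tau> q}) < (\<delta> - \<beta>) * real (card \<Omega>)})
        \<le> \<beta> * real (card C) ^ s"
  shows "real (card {\<tau> \<in> \<Omega>. \<beta> * real (card C) ^ s \<le> real (card {q \<in> {..<s} \<rightarrow>\<^sub>E C. G \<tau> q})})
      \<ge> (\<delta> - 3 * \<beta>) * real (card \<Omega>)"
proof -
  let ?Q = "{..<s} \<rightarrow>\<^sub>E C" and ?c = "real (card C) ^ s" and ?O = "real (card \<Omega>)"
  define Bad where "Bad = {q \<in> ?Q. real (card {\<tau> \<in> \<Omega>. G \<tau> q}) < (\<delta> - \<beta>) * ?O}"
  define good where "good \<tau> \<longleftrightarrow> \<beta> * ?c \<le> real (card {q \<in> ?Q. G \<tau> q})" for \<tau>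
  have finQ: "finite ?Q" using fin by (simp add: finite_PiE)
  have cQ: "real (card ?Q) = ?c" by (simp add: card_funcsetE)
  have c0: "?c > 0" using ne fin by (simp add: card_gt_0_iff)
  have "(\<delta> - 2 * \<beta>) * ?O * ?c \<le> (1 - \<beta>) * ?c * ((\<delta> - \<beta>) * ?O)"
  proof -
    have "\<beta> * \<delta> \<le> \<beta> * 1" using \<delta> by (intro mult_left_mono) auto
    moreover have "(1 - \<beta>) * (\<delta> - \<beta>) = \<delta> - \<beta> - \<beta> * \<delta> + \<beta> * \<beta>" by (simp add: algebra_simps)
    moreover have "0 \<le> \<beta> * \<beta>" by simp
    ultimately have "\<delta> - 2 * \<beta> \<le> (1 - \<beta>) * (\<delta> - \<beta>)" by linarith
    then have "(\<delta> - 2 * \<beta>) * (?O * ?c) \<le> (1 - \<beta>) * (\<delta> - \<beta>) * (?O * ?c)"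
      by (intro mult_right_mono) auto
    then show ?thesis by (simp add: mult_ac)
  qed
  also have "\<dots> \<le> real (card (?Q - Bad)) * ((\<delta> - \<beta>) * ?O)"
  proof (rule mult_right_mono)
    have "real (card (?Q - Bad)) = ?c - real (card Bad)"
      using finQ cQ card_mono[of ?Q Bad] by (subst card_Diff_subset) (auto simp: Bad_def)
    then show "(1 - \<beta>) * ?c \<le> real (card (?Q - Bad))"
      using bad unfolding Bad_def by (simp add: left_diff_distrib)
  qed (use \<delta> in auto)
  also have "\<dots> = (\<Sum>q\<in>?Q - Bad. (\<delta> - \<beta>) * ?O)" by simp
  also have "\<dots> \<le> (\<Sum>q\<in>?Q - Bad. real (card {\<tau> \<in> \<Omega>. G \<tau> q}))"
    by (intro sum_mono) (auto simp: Bad_def not_less)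
  also have "\<dots> \<le> (\<Sum>q\<in>?Q. real (card {\<tau> \<in> \<Omega>. G \<tau> q}))"
    using finQ by (intro sum_mono2) auto
  also have "\<dots> = (\<Sum>q\<in>?Q. \<Sum>\<tau>\<in>\<Omega>. of_bool (G \<tau> q))"
    using fin by (simp add: of_bool_def sum.inter_filter[symmetric])
  also have "\<dots> = (\<Sum>\<tau>\<in>\<Omega>. \<Sum>q\<in>?Q. of_bool (G \<tau> q))" by (rule sum.swap)
  also have "\<dots> = (\<Sum>\<tau>\<in>\<Omega>. real (card {q \<in> ?Q. G \<tau> q}))"
    using finQ by (simp add: of_bool_def sum.inter_filter[symmetric])
  also have "\<dots> \<le> (\<Sum>\<tau>\<in>\<Omega>. (if good \<tau> then ?c else 0) + \<beta> * ?c)"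
  proof (intro sum_mono)
    fix \<tau>
    have "real (card {q \<in> ?Q. G \<tau> q}) \<le> ?c"
      unfolding cQ[symmetric] using finQ by (intro of_nat_mono card_mono) auto
    then show "real (card {q \<in> ?Q. G \<tau> q}) \<le> (if good \<tau> then ?c else 0) + \<beta> * ?c"
      using \<delta> c0 unfolding good_def by (auto intro: add_increasing2)
  qed
  also have "\<dots> = (real (card {\<tau> \<in> \<Omega>. good \<tau>}) + \<beta> * ?O) * ?c"
    using fin by (simp add: sum.distrib sum.inter_filter[symmetric] algebra_simps)
  finally have "(\<delta> - 2 * \<beta>) * ?O \<le> real (card {\<tau> \<in> \<Omega>. good \<tau>}) + \<beta> * ?O"
    using c0 by (rule mult_right_le_imp_le)
  then show ?thesis unfolding good_def by (simp add: algebra_simps)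
qed

text \<open>Double counting over levels, vertices and \<tau>. At every level a fourth \<beta> is
  lost to small classes. The fifth goes to vertices outside the rich set: they are rich at fewer
  than \<open>v\<close> levels, that is, at less than a \<beta> share of them.\<close>

lemma rich_average:
  fixes \<delta> \<beta> :: real and X :: "'a set" and G :: "'t \<Rightarrow> (nat \<Rightarrow> 'a) \<Rightarrow> bool"
  assumes fin: "finite \<Omega>" "finite X" and ne: "X \<noteq> {}"
    and \<delta>: "3 * \<beta> \<le> \<delta>" "\<delta> \<le> 1" "0 < \<beta>" and L: "L > 0" "real v \<le> \<beta> * real L"
    and col: "\<And>l x. l < L \<Longrightarrow> x \<in> X \<Longrightarrow> c l x < N l"
    and \<rho>: "\<And>l. l < L \<Longrightarrow> \<rho> l > 0" "\<And>l. l < L \<Longrightarrow> real (N l) * \<rho> l \<le> \<beta>"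
    and bad: "\<And>l. l < L \<Longrightarrow> real (card {q \<in> {..<s} \<rightarrow>\<^sub>E X. real (card {\<tau> \<in> \<Omega>. G \<tau> q}) < (\<delta> - \<beta>) * real (card \<Omega>)})
        \<le> \<beta> * (\<rho> l * real (card X)) ^ s"
  shows "(\<Sum>\<tau>\<in>\<Omega>. real (card {x \<in> X. v \<le> card {l. l < L \<and> x \<in> rich_vertices (c l) X s (G \<tau>) (\<rho> l) \<beta>}}))
      \<ge> (\<delta> - 5 * \<beta>) * real (card X) * real (card \<Omega>)"
proof -
  let ?n = "real (card X)" and ?O = "real (card \<Omega>)"
  define K where "K \<tau> x = {l. l < L \<and> x \<in> rich_vertices (c l) X s (G \<tau>) (\<rho> l) \<beta>}" for \<tau> x
  define Z where "Z \<tau> = {x \<in> X. v \<le> card (K \<tau> x)}" for \<tau>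
  define C where "C l j = colour_class (c l) X j" for l j
  have n0: "?n > 0" using fin ne by (auto simp: card_gt_0_iff)
  have finC: "finite (C l j)" "C l j \<subseteq> X" for l j
    using fin by (auto simp: C_def colour_class_def)
  have level: "(\<delta> - 4 * \<beta>) * ?n * ?O
      \<le> (\<Sum>x\<in>X. real (card {\<tau> \<in> \<Omega>. x \<in> rich_vertices (c l) X s (G \<tau>) (\<rho> l) \<beta>}))" if l: "l < L" for l
  proof -
    define Small where "Small = {x \<in> X. real (card (C l (c l x))) < \<rho> l * ?n}"
    \<comment> \<open>At most \<open>N l\<close> classes have fewer than
      \<open>\<rho> l * ?n\<close> vertices, so together they cover at most
      \<open>real (N l) * \<rho> l * ?n\<close> vertices.\<close>
    have small: "real (card Small) \<le> \<beta> * ?n"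
    proof -
      let ?J = "{j \<in> {..<N l}. real (card (C l j)) < \<rho> l * ?n}"
      have "Small \<subseteq> (\<Union>j\<in>?J. C l j)"
        using col[OF l] by (auto simp: Small_def C_def colour_class_def)
      then have "card Small \<le> card (\<Union>j\<in>?J. C l j)"
        using finC by (intro card_mono) auto
      also have "\<dots> \<le> (\<Sum>j\<in>?J. card (C l j))" by (rule card_UN_le) auto
      finally have "real (card Small) \<le> (\<Sum>j\<in>?J. real (card (C l j)))"
        by (simp only: of_nat_sum[symmetric] of_nat_le_iff)
      also have "\<dots> \<le> (\<Sum>j\<in>?J. \<rho> l * ?n)" by (intro sum_mono) auto
      also have "\<dots> \<le> (\<Sum>j<N l. \<rho> l * ?n)"
        using \<rho>(1)[OF l] by (intro sum_mono2) auto
      also have "\<dots> = (real (N l) * \<rho> l) * ?n" by simp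
      also have "\<dots> \<le> \<beta> * ?n" using \<rho>(2)[OF l] by (intro mult_right_mono) auto
      finally show ?thesis .
    qed
    have big: "(\<delta> - 3 * \<beta>) * ?O \<le> real (card {\<tau> \<in> \<Omega>. x \<in> rich_vertices (c l) X s (G \<tau>) (\<rho> l) \<beta>})"
      if x: "x \<in> X - Small" for x
    proof -
      let ?D = "C l (c l x)"
      have D: "\<rho> l * ?n \<le> real (card ?D)" using x by (auto simp: Small_def)
      \<comment> \<open>The exceptional tuples of all of \<open>X\<close> are so few that even if
        all of them lay in \<open>?D\<close>, they would be at most a \<beta> share of its tuples.
        This is where the lower bound on the class size enters.\<close>
      have "real (card {q \<in> {..<s} \<rightarrow>\<^sub>E ?D. real (card {\<tau> \<in> \<Omega>. G \<tau> q}) < (\<delta> - \<beta>) * ?O})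
         \<le> real (card {q \<in> {..<s} \<rightarrow>\<^sub>E X. real (card {\<tau> \<in> \<Omega>. G \<tau> q}) < (\<delta> - \<beta>) * ?O})"
        using fin finC(2)[of l "c l x"] PiE_mono[of "{..<s}" "\<lambda>_. ?D" "\<lambda>_. X"]
        by (intro of_nat_mono card_mono) (auto simp: finite_PiE)
      also have "\<dots> \<le> \<beta> * (\<rho> l * ?n) ^ s" by (rule bad[OF l])
      also have "\<dots> \<le> \<beta> * real (card ?D) ^ s"
        using D \<rho>(1)[OF l] \<delta> n0 by (intro mult_left_mono power_mono) auto
      finally have "(\<delta> - 3 * \<beta>) * ?O
         \<le> real (card {\<tau> \<in> \<Omega>. \<beta> * real (card ?D) ^ s \<le> real (card {q \<in> {..<s} \<rightarrow>\<^sub>E ?D. G \<tau> q})})"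
        using fin finC \<delta> x by (intro rich_average_class) (auto simp: C_def colour_class_def)
      also have "{\<tau> \<in> \<Omega>. \<beta> * real (card ?D) ^ s \<le> real (card {q \<in> {..<s} \<rightarrow>\<^sub>E ?D. G \<tau> q})}
         = {\<tau> \<in> \<Omega>. x \<in> rich_vertices (c l) X s (G \<tau>) (\<rho> l) \<beta>}"
        using D x by (auto simp: rich_vertices_def C_def)
      finally show ?thesis .
    qed
    have "(\<delta> - 4 * \<beta>) * ?n * ?O \<le> ((1 - \<beta>) * ?n) * ((\<delta> - 3 * \<beta>) * ?O)"
    proof -
      have "\<beta> * \<delta> \<le> \<beta> * 1" using \<delta> by (intro mult_left_mono) auto
      moreover have "(1 - \<beta>) * (\<delta> - 3 * \<beta>) = \<delta> - 3 * \<beta> - \<beta> * \<delta> + 3 * (\<beta> * \<beta>)"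
        by (simp add: algebra_simps)
      moreover have "0 \<le> \<beta> * \<beta>" by simp
      ultimately have "\<delta> - 4 * \<beta> \<le> (1 - \<beta>) * (\<delta> - 3 * \<beta>)" by linarith
      then have "(\<delta> - 4 * \<beta>) * (?n * ?O) \<le> (1 - \<beta>) * (\<delta> - 3 * \<beta>) * (?n * ?O)"
        by (intro mult_right_mono) auto
      then show ?thesis by (simp add: mult_ac)
    qed
    also have "\<dots> \<le> real (card (X - Small)) * ((\<delta> - 3 * \<beta>) * ?O)"
    proof (rule mult_right_mono)
      have "real (card (X - Small)) = ?n - real (card Small)"
        using fin card_mono[of X Small] by (subst card_Diff_subset) (auto simp: Small_def)
      then show "(1 - \<beta>) * ?n \<le> real (card (X - Small))"
        using small by (simp add: left_diff_distrib)
    qed (use \<delta> in auto)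
    also have "\<dots> = (\<Sum>x\<in>X - Small. (\<delta> - 3 * \<beta>) * ?O)" by simp
    also have "\<dots> \<le> (\<Sum>x\<in>X - Small. real (card {\<tau> \<in> \<Omega>. x \<in> rich_vertices (c l) X s (G \<tau>) (\<rho> l) \<beta>}))"
      by (intro sum_mono big)
    also have "\<dots> \<le> (\<Sum>x\<in>X. real (card {\<tau> \<in> \<Omega>. x \<in> rich_vertices (c l) X s (G \<tau>) (\<rho> l) \<beta>}))"
      using fin by (intro sum_mono2) auto
    finally show ?thesis .
  qed
  let ?in = "\<lambda>\<tau> x l. of_bool (x \<in> rich_vertices (c l) X s (G \<tau>) (\<rho> l) \<beta>) :: real"
  have "real L * ((\<delta> - 4 * \<beta>) * ?n * ?O) = (\<Sum>l<L. (\<delta> - 4 * \<beta>) * ?n * ?O)" by simp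
  also have "\<dots> \<le> (\<Sum>l<L. \<Sum>x\<in>X. \<Sum>\<tau>\<in>\<Omega>. ?in \<tau> x l)"
    using level fin by (intro sum_mono) (simp add: of_bool_def sum.inter_filter[symmetric])
  also have "\<dots> = (\<Sum>\<tau>\<in>\<Omega>. \<Sum>x\<in>X. \<Sum>l<L. ?in \<tau> x l)"
  proof -
    have "(\<Sum>l<L. \<Sum>x\<in>X. \<Sum>\<tau>\<in>\<Omega>. ?in \<tau> x l) = (\<Sum>x\<in>X. \<Sum>l<L. \<Sum>\<tau>\<in>\<Omega>. ?in \<tau> x l)"
      by (rule sum.swap)
    also have "\<dots> = (\<Sum>x\<in>X. \<Sum>\<tau>\<in>\<Omega>. \<Sum>l<L. ?in \<tau> x l)"
      by (rule sum.cong[OF refl]) (rule sum.swap)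
    also have "\<dots> = (\<Sum>\<tau>\<in>\<Omega>. \<Sum>x\<in>X. \<Sum>l<L. ?in \<tau> x l)"
      by (rule sum.swap)
    finally show ?thesis .
  qed
  also have "\<dots> = (\<Sum>\<tau>\<in>\<Omega>. \<Sum>x\<in>X. real (card (K \<tau> x)))"
    by (simp add: K_def of_bool_def sum.inter_filter[symmetric])
  also have "\<dots> \<le> (\<Sum>\<tau>\<in>\<Omega>. \<Sum>x\<in>X. (if x \<in> Z \<tau> then real L else 0) + \<beta> * real L)"
  proof (intro sum_mono)
    fix \<tau> x assume x: "x \<in> X"
    have "card (K \<tau> x) \<le> card {..<L}" by (intro card_mono) (auto simp: K_def)
    then have "real (card (K \<tau> x)) \<le> real L" by simp
    then show "real (card (K \<tau> x)) \<le> (if x \<in> Z \<tau> then real L else 0) + \<beta> * real L"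
      using L x \<delta> by (auto simp: Z_def not_le)
  qed
  also have "\<dots> = (\<Sum>\<tau>\<in>\<Omega>. real (card (Z \<tau>)) * real L + ?n * (\<beta> * real L))"
  proof (intro sum.cong refl)
    fix \<tau>
    have "{x \<in> X. x \<in> Z \<tau>} = Z \<tau>" by (auto simp: Z_def)
    then show "(\<Sum>x\<in>X. (if x \<in> Z \<tau> then real L else 0) + \<beta> * real L)
       = real (card (Z \<tau>)) * real L + ?n * (\<beta> * real L)"
      using fin by (simp add: sum.distrib sum.inter_filter[symmetric])
  qed
  also have "\<dots> = real L * ((\<Sum>\<tau>\<in>\<Omega>. real (card (Z \<tau>))) + \<beta> * ?n * ?O)"
    by (simp add: sum.distrib sum_distrib_left algebra_simps)
  finally have "(\<delta> - 4 * \<beta>) * ?n * ?O \<le> (\<Sum>\<tau>\<in>\<Omega>. real (card (Z \<tau>))) + \<beta> * ?n * ?O"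
    by (rule mult_left_le_imp_le) (use L in simp)
  then show ?thesis unfolding Z_def K_def by (simp add: algebra_simps)
qed

section \<open>Homomorphisms of the augmentation\<close>

lemma card_aug_V:
  assumes "finite VF"
  shows "card (aug_V k s VF) = card VF * s + (k - s)"
  unfolding aug_V_def using assms
  by (subst card_Un_disjoint) (auto simp: card_image card_cartesian_product)

text \<open>A pair \<open>(\<tau>, \<psi>)\<close> glues to a map on the augmentation, with \<tau>
  on the new vertices and \<psi> on the copies, and can be recovered from it. Blow-up edges are
  preserved by the transversal condition, the added edges by the condition on each column.\<close>

lemma blowups_le_aug_homs:
  fixes VF :: "'b set" and EF :: "'b set set" and X :: "'a set" and EH :: "'a set set"
  defines "R \<equiv> \<lambda>\<phi>. \<forall>e\<in>EF. \<phi> ` e \<in> EH"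
  assumes F: "kgraph k VF EF" and finX: "finite X" and s: "s \<ge> 1"
  shows "(\<Sum>\<tau>\<in>{..<k - s} \<rightarrow>\<^sub>E X. card {\<psi> \<in> VF \<rightarrow>\<^sub>E ({..<s} \<rightarrow>\<^sub>E X).
      transversals_in R VF s VF \<psi> \<and> (\<forall>x\<in>VF. \<tau> ` {..<k - s} \<union> \<psi> x ` {..<s} \<in> EH)})
    \<le> card {\<chi> \<in> aug_V k s VF \<rightarrow>\<^sub>E X. \<forall>e\<in>aug_E k s VF EF. \<chi> ` e \<in> EH}"
proof -
  define B where "B \<tau> = {\<psi> \<in> VF \<rightarrow>\<^sub>E ({..<s} \<rightarrow>\<^sub>E X).
      transversals_in R VF s VF \<psi> \<and> (\<forall>x\<in>VF. \<tau> ` {..<k - s} \<union> \<psi> x ` {..<s} \<in> EH)}" for \<tau> :: "nat \<Rightarrow> 'a"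
  define glue where "glue = (\<lambda>(\<tau> :: nat \<Rightarrow> 'a, \<psi> :: 'b \<Rightarrow> nat \<Rightarrow> 'a).
      restrict (case_sum (\<lambda>(x, i). \<psi> x i) \<tau>) (aug_V k s VF))"
  let ?\<Omega> = "{..<k - s} \<rightarrow>\<^sub>E X"
  have finF: "finite VF" using F by (simp add: kgraph_def)
  have gl: "glue (\<tau>, \<psi>) (Inl (x, i)) = \<psi> x i" if "x \<in> VF" "i < s" for \<tau> \<psi> x i
    using that by (auto simp: glue_def aug_V_def)
  have gr: "glue (\<tau>, \<psi>) (Inr j) = \<tau> j" if "j < k - s" for \<tau> \<psi> j
    using that by (auto simp: glue_def aug_V_def)
  have finO: "finite ?\<Omega>" using finX by (simp add: finite_PiE)
  have finB: "finite (B \<tau>)" for \<tau>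
    unfolding B_def using finX finF by (simp add: finite_PiE)
  have "(\<Sum>\<tau>\<in>?\<Omega>. card (B \<tau>)) = card (Sigma ?\<Omega> B)"
    using finO finB by (simp add: card_SigmaI)
  also have "\<dots> \<le> card {\<chi> \<in> aug_V k s VF \<rightarrow>\<^sub>E X. \<forall>e\<in>aug_E k s VF EF. \<chi> ` e \<in> EH}"
  proof (rule card_inj_on_le[of glue])
    show "inj_on glue (Sigma ?\<Omega> B)"
    proof (rule inj_onI, clarsimp)
      fix \<tau> \<psi> \<tau>' \<psi>'
      assume t: "\<tau> \<in> ?\<Omega>" "\<tau>' \<in> ?\<Omega>" and p: "\<psi> \<in> B \<tau>" "\<psi>' \<in> B \<tau>'"
        and eq: "glue (\<tau>, \<psi>) = glue (\<tau>', \<psi>')"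
      have "\<tau> = \<tau>'"
      proof (rule PiE_ext[OF t])
        fix j assume "j \<in> {..<k - s}"
        then show "\<tau> j = \<tau>' j" using gr[of j \<tau> \<psi>] gr[of j \<tau>' \<psi>'] eq by simp
      qed
      moreover have "\<psi> = \<psi>'"
      proof (rule PiE_ext)
        show P: "\<psi> \<in> VF \<rightarrow>\<^sub>E ({..<s} \<rightarrow>\<^sub>E X)" "\<psi>' \<in> VF \<rightarrow>\<^sub>E ({..<s} \<rightarrow>\<^sub>E X)"
          using p by (auto simp: B_def)
        fix x assume x: "x \<in> VF"
        show "\<psi> x = \<psi>' x"
        proof (rule PiE_ext)
          show "\<psi> x \<in> {..<s} \<rightarrow>\<^sub>E X" "\<psi>' x \<in> {..<s} \<rightarrow>\<^sub>E X" using P x by (auto dest: PiE_mem)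
          fix i assume "i \<in> {..<s}"
          then show "\<psi> x i = \<psi>' x i" using gl[OF x, of i \<tau> \<psi>] gl[OF x, of i \<tau>' \<psi>'] eq by simp
        qed
      qed
      ultimately show "\<tau> = \<tau>' \<and> \<psi> = \<psi>'" by simp
    qed
    show "glue ` Sigma ?\<Omega> B \<subseteq> {\<chi> \<in> aug_V k s VF \<rightarrow>\<^sub>E X. \<forall>e\<in>aug_E k s VF EF. \<chi> ` e \<in> EH}"
    proof clarsimp
      fix \<tau> \<psi> assume t: "\<tau> \<in> ?\<Omega>" and p: "\<psi> \<in> B \<tau>"
      have P: "\<psi> \<in> VF \<rightarrow>\<^sub>E ({..<s} \<rightarrow>\<^sub>E X)" using p by (auto simp: B_def)
      have "glue (\<tau>, \<psi>) \<in> aug_V k s VF \<rightarrow>\<^sub>E X"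
      proof (rule PiE_I)
        fix z assume z: "z \<in> aug_V k s VF"
        then consider x i where "z = Inl (x, i)" "x \<in> VF" "i < s" | j where "z = Inr j" "j < k - s"
          by (auto simp: aug_V_def)
        then show "glue (\<tau>, \<psi>) z \<in> X"
        proof cases
          case 1
          then show ?thesis using gl PiE_mem[OF PiE_mem[OF P, of x], of i] by simp
        next
          case 2
          then show ?thesis using gr PiE_mem[OF t, of j] by simp
        qed
      qed (simp add: glue_def)
      moreover have "glue (\<tau>, \<psi>) ` e' \<in> EH" if "e' \<in> aug_E k s VF EF" for e'
        using that unfolding aug_E_def
      proof
        assume "e' \<in> {(\<lambda>x. Inl (x, f x)) ` e | e f. e \<in> EF \<and> f \<in> e \<rightarrow> {..<s}}"
        then obtain e f where e: "e' = (\<lambda>x. Inl (x, f x)) ` e" "e \<in> EF" "f \<in> e \<rightarrow> {..<s}" by blast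
        have eV: "e \<subseteq> VF" using F e by (auto simp: kgraph_def)
        \<comment> \<open>The choice of copies is given on \<open>e\<close> only; it is extended by
          0 to all vertices, which is a legal index as \<open>s \<ge> 1\<close>, and the image of
          \<open>e\<close> does not change.\<close>
        let ?g = "\<lambda>x\<in>VF. if x \<in> e then f x else 0"
        have "?g \<in> VF \<rightarrow>\<^sub>E {..<s}" using e(3) s by auto
        then have "R (\<lambda>x\<in>VF. \<psi> x (?g x))"
          using p unfolding B_def transversals_in_def by blast
        then have "(\<lambda>x\<in>VF. \<psi> x (?g x)) ` e \<in> EH"
          using e(2) unfolding R_def by (rule bspec)
        also have "(\<lambda>x\<in>VF. \<psi> x (?g x)) ` e = glue (\<tau>, \<psi>) ` e'"
          unfolding e(1) image_image
        proof (rule image_cong[OF refl])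
          fix x assume x: "x \<in> e"
          then have "f x < s" "x \<in> VF" using e(3) eV by auto
          then show "(\<lambda>x\<in>VF. \<psi> x (?g x)) x = glue (\<tau>, \<psi>) (Inl (x, f x))"
            using x gl by simp
        qed
        finally show ?thesis .
      next
        assume "e' \<in> {Inr ` {..<k - s} \<union> Inl ` ({x} \<times> {..<s}) | x. x \<in> VF}"
        then obtain x where x: "e' = Inr ` {..<k - s} \<union> Inl ` ({x} \<times> {..<s})" "x \<in> VF" by blast
        have "glue (\<tau>, \<psi>) ` Inr ` {..<k - s} = \<tau> ` {..<k - s}"
          unfolding image_image using gr by (intro image_cong) auto
        moreover have "glue (\<tau>, \<psi>) ` Inl ` ({x} \<times> {..<s}) = \<psi> x ` {..<s}"
        proof -
          have "{x} \<times> {..<s} = Pair x ` {..<s}" by auto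
          then show ?thesis
            unfolding image_image using gl[OF x(2)] by (simp add: image_image)
        qed
        ultimately have "glue (\<tau>, \<psi>) ` e' = \<tau> ` {..<k - s} \<union> \<psi> x ` {..<s}"
          unfolding x(1) image_Un by simp
        then show ?thesis using p x(2) by (simp add: B_def)
      qed
      ultimately show "glue (\<tau>, \<psi>) \<in> aug_V k s VF \<rightarrow>\<^sub>E X \<and> (\<forall>e\<in>aug_E k s VF EF. glue (\<tau>, \<psi>) ` e \<in> EH)"
        by blast
    qed
    show "finite {\<chi> \<in> aug_V k s VF \<rightarrow>\<^sub>E X. \<forall>e\<in>aug_E k s VF EF. \<chi> ` e \<in> EH}"
      using finX finF by (simp add: finite_PiE aug_V_def)
  qed
  finally show ?thesis unfolding B_def .
qed

section \<open>Choice of the parameters and conclusion\<close>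

theorem mainTheorem10:
  fixes k s :: nat and VF :: "'b set" and EF :: "'b set set"
  assumes "k \<ge> 2" and "1 \<le> s" and "s \<le> k - 1" and "kgraph k VF EF"
  shows "\<exists>\<epsilon>0>0. \<forall>\<epsilon>::real. 0 < \<epsilon> \<and> \<epsilon> < \<epsilon>0 \<longrightarrow>
          (\<exists>\<theta>0>0. \<forall>\<theta>::real. 0 < \<theta> \<and> \<theta> < \<theta>0 \<longrightarrow>
            (\<exists>n0::nat. \<forall>n\<ge>n0. \<forall>\<delta>::real. 0 < \<delta> \<and> \<delta> < 1 \<longrightarrow>
              (\<forall>(X::'a set) EH. card X = n \<and> kgraph k X EH
                 \<and> hom_density (aug_V k s VF) (aug_E k s VF EF) X EH < \<theta>
                 \<and> graph_density n s
                     {S. S \<subseteq> X \<and> card S = s \<and>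
                         real (card (nbhd X EH S)) < \<delta> * real ((n - s) choose (k - s))} < \<theta>
                 \<longrightarrow> (\<exists>Z\<subseteq>X. real (card Z) > (\<delta> - \<epsilon>) * real n
                        \<and> hom_density VF EF Z {e \<in> EH. e \<subseteq> Z} < \<epsilon>))))"
proof (rule exI[of _ "1::real"], intro conjI allI impI)
  fix \<epsilon> :: real assume \<epsilon>: "0 < \<epsilon> \<and> \<epsilon> < 1"
  have s: "s \<ge> 1" "s \<le> k" using assms by auto
  have finF: "finite VF" using assms(4) by (simp add: kgraph_def)
  define v where "v = card VF"
  \<comment> \<open>The losses add up to 6 times \<beta>, which is \<open>\<epsilon> / 2\<close>:
    five in \<open>rich_average\<close> and one for the \<tau> that lie in many copies of the
    augmentation. For \<open>\<delta> \<ge> \<epsilon>\<close> the set found still has at least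
    \<open>\<epsilon> / 2 * real n\<close> vertices.\<close>
  define \<beta> where "\<beta> = \<epsilon> / 12"
  define M where "M = 2 ^ v * real v"
  define L where "L = nat \<lceil>real v / \<beta>\<rceil>"
  \<comment> \<open>All parameters of a level are functions of the density \<open>g\<close> that is
    available when the level is reached. \<open>eta\<close> is the regularity that
    \<open>column_step\<close> demands at that density.\<close>
  define eta where "eta g = min ((g / M) / 4) (\<beta> * ((g / M) / 4) ^ s / (2 * real s))" for g
  \<comment> \<open>The number of refinement rounds; the added 1 makes
    \<open>K * eta ^ 4 > 1\<close> strict.\<close>
  define K where "K g = nat \<lceil>1 / eta g ^ 4\<rceil> + 1" for g
  \<comment> \<open>With at most \<open>2 ^ K g\<close> classes, those below this relative size
    cover at most a \<beta> share of the vertices.\<close>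
  define rho where "rho g = \<beta> / 2 ^ K g" for g
  \<comment> \<open>The density left after one replacement. The minimum with \<open>g\<close> also
    covers levels at which no column is replaced.\<close>
  define gstep where "gstep g = min g (rho g ^ s * (\<beta> * ((g / M) / 4) ^ s / 2))" for g
  \<comment> \<open>Initial density: a set of at least \<open>\<epsilon> / 2 * n\<close> vertices
    with homomorphism density at least \<epsilon>, divided by the number of level
    assignments.\<close>
  define \<gamma> where "\<gamma> l = (gstep ^^ l) (\<epsilon> * (\<epsilon> / 2) ^ v / real L ^ v)" for l
  define \<eta> where "\<eta> l = eta (\<gamma> l)" for l
  define \<rho> where "\<rho> l = rho (\<gamma> l)" for l
  have \<beta>: "\<beta> > 0" "\<epsilon> = 12 * \<beta>" using \<epsilon> by (auto simp: \<beta>_def)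
  show "\<exists>\<theta>0>0. \<forall>\<theta>::real. 0 < \<theta> \<and> \<theta> < \<theta>0 \<longrightarrow>
            (\<exists>n0::nat. \<forall>n\<ge>n0. \<forall>\<delta>::real. 0 < \<delta> \<and> \<delta> < 1 \<longrightarrow>
              (\<forall>(X::'a set) EH. card X = n \<and> kgraph k X EH
                 \<and> hom_density (aug_V k s VF) (aug_E k s VF EF) X EH < \<theta>
                 \<and> graph_density n s
                     {S. S \<subseteq> X \<and> card S = s \<and>
                         real (card (nbhd X EH S)) < \<delta> * real ((n - s) choose (k - s))} < \<theta>
                 \<longrightarrow> (\<exists>Z\<subseteq>X. real (card Z) > (\<delta> - \<epsilon>) * real n
                        \<and> hom_density VF EF Z {e \<in> EH. e \<subseteq> Z} < \<epsilon>)))"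
  \<comment> \<open>Without vertices there are no edges either, as edges have
    \<open>k \<ge> 2\<close> elements. The augmentation is then edgeless and has density 1, so its
    hypothesis fails for \<open>\<theta> < 1\<close>.\<close>
  proof (cases "VF = {}")
    case True
    have noF: "EF = {}" using assms(1,4) True by (auto simp: kgraph_def)
    have hd: "hom_density (aug_V k s VF) (aug_E k s VF EF) X EH = 1" if "card X > 0" for X :: "'a set" and EH
    proof -
      have "aug_E k s VF EF = {}" unfolding aug_E_def True noF by simp
      moreover have "finite (aug_V k s VF)" using finF by (simp add: aug_V_def)
      ultimately show ?thesis using that by (simp add: hom_density_def card_funcsetE)
    qed
    show ?thesis
      by (rule exI[of _ "1::real"], intro conjI allI impI, simp, rule exI[of _ "1::nat"])
        (use hd in force)
  next
    case False
    then have v0: "v > 0" using finF by (simp add: v_def card_gt_0_iff)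
    have M0: "M > 0" using v0 by (simp add: M_def)
    have L0: "L > 0" using v0 \<beta> by (simp add: L_def)
    have vL: "real v \<le> \<beta> * real L"
    proof -
      have "real v / \<beta> \<le> real L" unfolding L_def by (rule of_nat_ceiling)
      then show ?thesis using \<beta> by (simp add: divide_le_eq mult.commute)
    qed
    have eta0: "eta g > 0" if "g > 0" for g using that M0 \<beta> s by (simp add: eta_def)
    have rho0: "rho g > 0" for g using \<beta> by (simp add: rho_def)
    have \<gamma>S: "\<gamma> (Suc l) = gstep (\<gamma> l)" for l by (simp add: \<gamma>_def)
    have \<gamma>0: "\<gamma> l > 0" for l
    proof (induction l)
      case 0
      show ?case using \<epsilon> L0 by (simp add: \<gamma>_def)
    next
      case (Suc l)
      then show ?case unfolding \<gamma>S gstep_def using rho0[of "\<gamma> l"] \<beta> M0 by simp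
    qed
    have \<rho>0: "\<rho> l > 0" for l by (simp add: \<rho>_def rho0)
    have \<eta>0: "\<eta> l > 0" for l by (simp add: \<eta>_def eta0 \<gamma>0)
    have step: "\<gamma> (Suc l) \<le> \<gamma> l" "\<gamma> (Suc l) \<le> \<rho> l ^ s * (\<beta> * ((\<gamma> l / M) / 4) ^ s / 2)" for l
      unfolding \<gamma>S gstep_def \<rho>_def by (rule min.cobounded1, rule min.cobounded2)
    have \<eta>1: "\<eta> l \<le> (\<gamma> l / M) / 4" for l
      unfolding \<eta>_def eta_def by (rule min.cobounded1)
    have \<eta>2: "real s * \<eta> l \<le> \<beta> * ((\<gamma> l / M) / 4) ^ s / 2" for l
    proof -
      have "real s * \<eta> l \<le> real s * (\<beta> * ((\<gamma> l / M) / 4) ^ s / (2 * real s))"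
        unfolding \<eta>_def eta_def by (intro mult_left_mono min.cobounded2) auto
      then show ?thesis using s by simp
    qed
    have K: "real (K (\<gamma> l)) * \<eta> l ^ 4 > 1" for l
    proof -
      have "1 / \<eta> l ^ 4 < real (K (\<gamma> l))"
        unfolding K_def \<eta>_def using of_nat_ceiling[of "1 / eta (\<gamma> l) ^ 4"] by linarith
      then show ?thesis using \<eta>0[of l] by (simp add: divide_less_eq)
    qed
    \<comment> \<open>The bound \<open>\<beta> * \<gamma> L\<close> makes it rare for a \<tau> to
      lie in many copies of the augmentation. The other bounds make the tuples of low degree
      negligible within one large class of any level.\<close>
    define \<theta>0 where "\<theta>0 = Min (insert (\<beta> * \<gamma> L) ((\<lambda>l. \<beta> * \<rho> l ^ s / 2) ` {..<L}))"
    have \<theta>0: "\<theta>0 > 0" unfolding \<theta>0_def using \<beta> \<gamma>0 \<rho>0 by (subst Min_gr_iff) auto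
    show ?thesis
    proof (intro exI[of _ \<theta>0] conjI allI impI)
      show "\<theta>0 > 0" by (rule \<theta>0)
      fix \<theta> :: real assume \<theta>: "0 < \<theta> \<and> \<theta> < \<theta>0"
      have \<theta>1: "\<theta> < \<beta> * \<gamma> L" using \<theta> unfolding \<theta>0_def by (subst (asm) Min_gr_iff) auto
      have \<theta>2: "2 * \<theta> \<le> \<beta> * \<rho> l ^ s" if "l < L" for l
      proof -
        have "\<theta> < \<beta> * \<rho> l ^ s / 2"
          using \<theta> that unfolding \<theta>0_def by (subst (asm) Min_gr_iff) auto
        then show ?thesis by simp
      qed
      define n0 where "n0 = nat \<lceil>real k * real k / min \<theta> \<beta>\<rceil> + k + 1"
      show "\<exists>n0::nat. \<forall>n\<ge>n0. \<forall>\<delta>::real. 0 < \<delta> \<and> \<delta> < 1 \<longrightarrow>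
              (\<forall>(X::'a set) EH. card X = n \<and> kgraph k X EH
                 \<and> hom_density (aug_V k s VF) (aug_E k s VF EF) X EH < \<theta>
                 \<and> graph_density n s
                     {S. S \<subseteq> X \<and> card S = s \<and>
                         real (card (nbhd X EH S)) < \<delta> * real ((n - s) choose (k - s))} < \<theta>
                 \<longrightarrow> (\<exists>Z\<subseteq>X. real (card Z) > (\<delta> - \<epsilon>) * real n
                        \<and> hom_density VF EF Z {e \<in> EH. e \<subseteq> Z} < \<epsilon>))"
      proof (intro exI[of _ n0] allI impI, elim conjE)
        fix n \<delta> and X :: "'a set" and EH
        assume n: "n \<ge> n0" and \<delta>: "0 < \<delta>" "\<delta> < (1::real)" and cX: "card X = n"
          and H: "kgraph k X EH"
          and hom: "hom_density (aug_V k s VF) (aug_E k s VF EF) X EH < \<theta>"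
          and low: "graph_density n s {S. S \<subseteq> X \<and> card S = s \<and>
                         real (card (nbhd X EH S)) < \<delta> * real ((n - s) choose (k - s))} < \<theta>"
        have kn: "k \<le> n" "n > 0" using n by (auto simp: n0_def)
        have kkn: "real k * real k / real n \<le> min \<theta> \<beta>"
        proof -
          have "real k * real k / min \<theta> \<beta> \<le> real n"
            using n of_nat_ceiling[of "real k * real k / min \<theta> \<beta>"] unfolding n0_def by linarith
          moreover have "min \<theta> \<beta> > 0" using \<theta> \<beta> by simp
          ultimately have "real k * real k \<le> real n * min \<theta> \<beta>" by (simp only: pos_divide_le_eq)
          then show ?thesis using kn by (simp only: pos_divide_le_eq of_nat_0_less_iff mult.commute)
        qed
        have finX: "finite X" and neX: "X \<noteq> {}" using H cX kn by (auto simp: kgraph_def)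
        show "\<exists>Z\<subseteq>X. real (card Z) > (\<delta> - \<epsilon>) * real n \<and> hom_density VF EF Z {e \<in> EH. e \<subseteq> Z} < \<epsilon>"
        proof (cases "\<delta> < \<epsilon>")
          \<comment> \<open>The empty set works, since its homomorphism density is \<open>0 / 0 = 0\<close>.\<close>
          case True
          have "VF \<rightarrow>\<^sub>E ({} :: 'a set) = {}" using False by (auto simp: PiE_eq_empty_iff)
          then have "hom_density VF EF ({} :: 'a set) {e \<in> EH. e \<subseteq> {}} = 0"
            by (simp add: hom_density_def)
          moreover have "(\<delta> - \<epsilon>) * real n < 0" using True kn by (simp add: mult_neg_pos)
          ultimately show ?thesis using \<epsilon> by (intro exI[of _ "{}"]) auto
        next
          case \<delta>\<epsilon>: False
          define R where "R \<phi> \<longleftrightarrow> (\<forall>e\<in>EF. \<phi> ` e \<in> EH)" for \<phi> :: "'b \<Rightarrow> 'a"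
          define U where "U = fibre_index VF s X"
          define \<Omega> where "\<Omega> = {..<k - s} \<rightarrow>\<^sub>E X"
          define G where "G \<tau> q \<longleftrightarrow> \<tau> ` {..<k - s} \<union> q ` {..<s} \<in> EH" for \<tau> q :: "nat \<Rightarrow> 'a"
          have finU: "finite U" unfolding U_def using finF finX by (rule finite_fibre_index)
          have neU: "U \<noteq> {}"
          proof -
            have "card U > 0"
              unfolding U_def using finF finX v0 kn cX by (simp add: card_fibre_index v_def)
            then show ?thesis by auto
          qed
          \<comment> \<open>Regularity is required only of the fibres of copies of the original
            graph, which do not involve \<tau>. Hence one sequence of colourings serves all \<tau>
            simultaneously.\<close>
          have "\<forall>l. \<exists>c. (\<forall>x\<in>X. c x < 2 ^ K (\<gamma> l)) \<and>
              real (card {x \<in> X. irregular c X U (fibre R VF s) (\<eta> l) (c x)}) \<le> \<eta> l * real (card X)"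
          proof
            fix l
            show "\<exists>c. (\<forall>x\<in>X. c x < 2 ^ K (\<gamma> l)) \<and>
              real (card {x \<in> X. irregular c X U (fibre R VF s) (\<eta> l) (c x)}) \<le> \<eta> l * real (card X)"
            proof (rule regular_colouring_exists[OF finX finU neX neU \<eta>0 _ K])
              show "0 \<le> fibre R VF s u x \<and> fibre R VF s u x \<le> 1" for u x
                by (auto simp: fibre_def split: prod.splits)
            qed
          qed
          from choice[OF this] obtain c where
            "\<forall>l. (\<forall>x\<in>X. c l x < 2 ^ K (\<gamma> l)) \<and>
              real (card {x \<in> X. irregular (c l) X U (fibre R VF s) (\<eta> l) (c l x)}) \<le> \<eta> l * real (card X)" ..
          then have col: "\<And>l x. x \<in> X \<Longrightarrow> c l x < 2 ^ K (\<gamma> l)"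
            and reg: "\<And>l. real (card {x \<in> X. irregular (c l) X U (fibre R VF s) (\<eta> l) (c l x)})
                \<le> \<eta> l * real (card X)"
            by blast+
          have finO: "finite \<Omega>" unfolding \<Omega>_def using finX by (simp add: finite_PiE)
          have cO: "real (card \<Omega>) = real n ^ (k - s)" by (simp add: \<Omega>_def card_funcsetE cX)
          define Z where "Z \<tau> = {x \<in> X. v \<le> card {l. l < L \<and> x \<in> rich_vertices (c l) X s (G \<tau>) (\<rho> l) \<beta>}}" for \<tau>
          define cnt where "cnt \<tau> = card {\<psi> \<in> VF \<rightarrow>\<^sub>E ({..<s} \<rightarrow>\<^sub>E X).
              transversals_in R VF s VF \<psi> \<and> (\<forall>x\<in>VF. G \<tau> (\<psi> x))}" for \<tau>
          let ?q = "real n ^ (s * v)"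
          have q0: "?q > 0" and O0: "real (card \<Omega>) > 0" using kn by (auto simp: cO)
          have sumZ: "(\<Sum>\<tau>\<in>\<Omega>. real (card (Z \<tau>))) \<ge> (\<delta> - 5 * \<beta>) * real (card X) * real (card \<Omega>)"
            unfolding Z_def
          proof (rule rich_average[where N = "\<lambda>l. 2 ^ K (\<gamma> l)"])
            show "real (2 ^ K (\<gamma> l)) * \<rho> l \<le> \<beta>" for l by (simp add: \<rho>_def rho_def)
            show "real (card {q \<in> {..<s} \<rightarrow>\<^sub>E X. real (card {\<tau> \<in> \<Omega>. G \<tau> q}) < (\<delta> - \<beta>) * real (card \<Omega>)})
                \<le> \<beta> * (\<rho> l * real (card X)) ^ s" if l: "l < L" for l
            proof -
              have "real (card {q \<in> {..<s} \<rightarrow>\<^sub>E X. real (card {\<tau> \<in> \<Omega>. G \<tau> q}) < (\<delta> - \<beta>) * real (card \<Omega>)})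
                 \<le> 2 * \<theta> * real (card X) ^ s"
                unfolding \<Omega>_def[symmetric] cO cX[symmetric] G_def unfolding \<Omega>_def
                using H s(2) kn kkn \<delta> low unfolding cX[symmetric]
                by (intro few_low_degree_tuples) auto
              also have "\<dots> \<le> \<beta> * \<rho> l ^ s * real (card X) ^ s"
                using \<theta>2[OF l] by (intro mult_right_mono) auto
              finally show ?thesis by (simp add: power_mult_distrib mult_ac)
            qed
          qed (use finO finX neX \<delta> \<delta>\<epsilon> \<beta> L0 vL col \<rho>0 in auto)
          \<comment> \<open>As \<open>card \<Omega>\<close> equals \<open>n ^ (k - s)\<close>, this
            says that on average at most a \<theta> share of the \<open>?q\<close> possible column
            systems completes a given \<tau> to a copy of the augmentation.\<close>
          have sumc: "(\<Sum>\<tau>\<in>\<Omega>. real (cnt \<tau>)) \<le> \<theta> * ?q * real (card \<Omega>)"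
          proof -
            let ?H = "card {\<chi> \<in> aug_V k s VF \<rightarrow>\<^sub>E X. \<forall>e\<in>aug_E k s VF EF. \<chi> ` e \<in> EH}"
            have "(\<Sum>\<tau>\<in>\<Omega>. cnt \<tau>) \<le> ?H"
              unfolding \<Omega>_def cnt_def R_def[abs_def] G_def
              by (rule blowups_le_aug_homs[OF assms(4) finX s(1)])
            then have "(\<Sum>\<tau>\<in>\<Omega>. real (cnt \<tau>)) \<le> real ?H"
              by (simp only: of_nat_sum[symmetric] of_nat_le_iff)
            also have "\<dots> \<le> \<theta> * real n ^ (v * s + (k - s))"
              using hom kn unfolding hom_density_def card_aug_V[OF finF] cX v_def
              by (simp add: divide_less_eq)
            finally show ?thesis by (simp add: cO power_add mult_ac)
          qed
          have "\<exists>\<tau>\<in>\<Omega>. real (card (Z \<tau>)) > (\<delta> - 6 * \<beta>) * real n \<and> real (cnt \<tau>) < \<gamma> L * ?q"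
          proof (rule ccontr)
            assume neg: "\<not> ?thesis"
            \<comment> \<open>The factor is scaled so that
              \<open>cnt \<tau> \<ge> \<gamma> L * ?q\<close> forces
              \<open>?f * cnt \<tau> \<ge> n\<close>, which pays for any size of
              \<open>Z \<tau>\<close>. Summed over \<Omega> this payment is below a \<beta> share,
              contradicting \<open>sumZ\<close>.\<close>
            let ?f = "real n / (\<gamma> L * ?q)"
            have "real (card (Z \<tau>)) \<le> (\<delta> - 6 * \<beta>) * real n + ?f * real (cnt \<tau>)" if t: "\<tau> \<in> \<Omega>" for \<tau>
            proof (cases "real (card (Z \<tau>)) \<le> (\<delta> - 6 * \<beta>) * real n")
              case True
              moreover have "0 \<le> ?f * real (cnt \<tau>)" using \<gamma>0[of L] by simp
              ultimately show ?thesis by linarith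
            next
              case False
              then have "real (cnt \<tau>) \<ge> \<gamma> L * ?q" using neg t by (auto simp: not_le not_less)
              then have "?f * (\<gamma> L * ?q) \<le> ?f * real (cnt \<tau>)"
                using \<gamma>0[of L] by (intro mult_left_mono) auto
              moreover have "?f * (\<gamma> L * ?q) = real n" using \<gamma>0[of L] q0 by simp
              moreover have "card (Z \<tau>) \<le> n"
                unfolding cX[symmetric] using finX by (intro card_mono) (auto simp: Z_def)
              moreover have "0 \<le> (\<delta> - 6 * \<beta>) * real n" using \<delta>\<epsilon> \<beta> by simp
              ultimately show ?thesis by linarith
            qed
            then have "(\<Sum>\<tau>\<in>\<Omega>. real (card (Z \<tau>))) \<le> (\<Sum>\<tau>\<in>\<Omega>. (\<delta> - 6 * \<beta>) * real n + ?f * real (cnt \<tau>))"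
              by (rule sum_mono)
            also have "\<dots> = (\<delta> - 6 * \<beta>) * real n * real (card \<Omega>) + ?f * (\<Sum>\<tau>\<in>\<Omega>. real (cnt \<tau>))"
              by (simp add: sum.distrib sum_distrib_left)
            also have "\<dots> \<le> (\<delta> - 6 * \<beta>) * real n * real (card \<Omega>) + ?f * (\<theta> * ?q * real (card \<Omega>))"
              using sumc \<gamma>0[of L] by (intro add_left_mono mult_left_mono) auto
            also have "?f * (\<theta> * ?q * real (card \<Omega>)) = \<theta> / \<gamma> L * (real n * real (card \<Omega>))"
              using q0 by (simp add: field_simps)
            also have "\<dots> < \<beta> * (real n * real (card \<Omega>))"
              using \<theta>1 \<gamma>0[of L] kn O0 by (intro mult_strict_right_mono) (auto simp: divide_less_eq)
            finally have "(\<Sum>\<tau>\<in>\<Omega>. real (card (Z \<tau>))) < (\<delta> - 5 * \<beta>) * real n * real (card \<Omega>)"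
              by (simp add: algebra_simps)
            then show False using sumZ cX by simp
          qed
          then obtain \<tau> where \<tau>: "real (card (Z \<tau>)) > (\<delta> - 6 * \<beta>) * real n" "real (cnt \<tau>) < \<gamma> L * ?q"
            by blast
          have ZX: "Z \<tau> \<subseteq> X" by (auto simp: Z_def)
          have "hom_density VF EF (Z \<tau>) {e \<in> EH. e \<subseteq> Z \<tau>} < \<epsilon>"
          proof (rule ccontr)
            assume dense: "\<not> ?thesis"
            have Zbig: "\<epsilon> / 2 * real n \<le> real (card (Z \<tau>))"
            proof -
              have "\<epsilon> / 2 * real n \<le> (\<delta> - 6 * \<beta>) * real n"
                using \<delta>\<epsilon> \<beta> by (intro mult_right_mono) auto
              then show ?thesis using \<tau>(1) by linarith
            qed
            then have Z0: "real (card (Z \<tau>)) > 0"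
              using \<epsilon> kn by (meson half_gt_zero less_le_trans mult_pos_pos of_nat_0_less_iff)
            \<comment> \<open>Homomorphism density in \<open>Z \<tau>\<close> is relative to its own
              size; the lower bound on that size converts it into a count relative to
              \<open>n\<close>, which is what \<open>\<gamma> 0\<close> was chosen for.\<close>
            have "\<gamma> 0 * real L ^ v * real n ^ v = \<epsilon> * (\<epsilon> / 2 * real n) ^ v"
              unfolding power_mult_distrib using L0 by (simp add: \<gamma>_def)
            also have "\<dots> \<le> \<epsilon> * real (card (Z \<tau>)) ^ v"
              using Zbig \<epsilon> by (intro mult_left_mono power_mono) auto
            also have "\<dots> \<le> real (card {\<phi> \<in> VF \<rightarrow>\<^sub>E Z \<tau>. \<forall>e\<in>EF. \<phi> ` e \<in> {e \<in> EH. e \<subseteq> Z \<tau>}})"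
              using dense Z0 unfolding hom_density_def v_def by (simp add: not_less le_divide_eq)
            also have "\<dots> \<le> real (card {\<phi> \<in> VF \<rightarrow>\<^sub>E Z \<tau>. R \<phi>})"
              using finF finite_subset[OF ZX finX]
              by (intro of_nat_mono card_mono) (auto simp: R_def finite_PiE)
            finally have lower: "\<gamma> 0 * real L ^ card VF * real (card X) ^ card VF
                \<le> real (card {\<phi> \<in> VF \<rightarrow>\<^sub>E Z \<tau>. R \<phi>})"
              by (simp add: v_def cX)
            have "\<gamma> L * real (card X ^ s) ^ card VF \<le> real (cnt \<tau>)"
              unfolding cnt_def
            proof (rule blow_up_rich[where Z = "Z \<tau>" and \<epsilon> = \<beta> and \<gamma> = \<gamma> and \<eta> = \<eta> and \<rho> = \<rho> and c = c])
              show "Z \<tau> = {x \<in> X. card VF \<le> card {l. l < L \<and> x \<in> rich_vertices (c l) X s (G \<tau>) (\<rho> l) \<beta>}}"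
                by (simp add: Z_def v_def)
              show "\<gamma> 0 * real L ^ card VF * real (card X) ^ card VF \<le> real (card {\<phi> \<in> VF \<rightarrow>\<^sub>E Z \<tau>. R \<phi>})"
                by (rule lower)
            qed (use finF finX neX s(1) L0 \<beta> \<gamma>0 \<rho>0 \<eta>0 step \<eta>1 \<eta>2 reg in \<open>auto simp: M_def v_def U_def less_imp_le\<close>)
            moreover have "real (card X ^ s) ^ card VF = ?q"
              by (simp add: cX v_def power_mult)
            ultimately show False using \<tau>(2) by simp
          qed
          moreover have "(\<delta> - \<epsilon>) * real n \<le> (\<delta> - 6 * \<beta>) * real n"
            using \<beta> by (intro mult_right_mono) auto
          ultimately show ?thesis using \<tau>(1) ZX by (intro exI[of _ "Z \<tau>"]) auto
        qed
      qed
    qed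
  qed
qed simp

end
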